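(* Let $\mu=(\mu_k)_{k\ge 0}$ be a probability distribution on $\mathbb{N}=\{0,1,2,\dots\}$ with $|\mu|_1\le 1$ and $|\mu|_2=\infty$. Then $n^{-1/2}\,\mathrm{ht}(\mathrm{T}_{\mu,n})\to 0$ as $n\to\infty$ along values $n$ such that $\mathbf{P}(|\mathrm{T}_\mu|=n)>0$, both in probability and in expectation.
   Context: For $p>0$, $|\mu|_p=\left(\sum_{k\ge 0}k^p\mu_k\right)^{1/p}$. A plane tree is a rooted, unlabeled finite tree in which the set of children of each node carries a (left-to-right) total order. $\mathrm{T}_\mu$ is the Bienaymé (Galton–Watson) tree with offspring distribution $\mu$, i.e. the family tree of a branching process with offspring distribution $\mu$; for every finite plane tree $\mathrm{t}$, $\mathbf{P}(\mathrm{T}_\mu=\mathrm{t})=\prod_{v}\mu_{d_{\mathrm{t}}(v)}$, where the product is over vertices $v$ of $\mathrm{t}$ and $d_{\mathrm{t}}(v)$ is the number of children of $v$. $|\mathrm{T}_\mu|$ is its number of vertices, and for $n$ with $\mathbf{P}(|\mathrm{T}_\mu|=n)>0$, $\mathrm{T}_{\mu,n}$ is $\mathrm{T}_\mu$ conditioned to have exactly $n$ vertices. The height $\mathrm{ht}(\mathrm{t})$ is the maximum graph distance from the root to a vertex of $\mathrm{t}$. *)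

theory Defs
  imports "HOL-Probability.Probability"
begin

text \<open>
  The extended-real-valued norm \<open>(\<Sum>k. k powr p * \<mu> k) powr (1 / p)\<close> of a distribution on the
  naturals, for \<open>p > 0\<close>.  The case distinction only extends \<open>powr\<close> to \<open>\<infinity>\<close>.
\<close>

definition moment_norm :: "real \<Rightarrow> nat pmf \<Rightarrow> ennreal" where
  "moment_norm p \<mu> =
     (let S = (\<Sum>k. ennreal (real k powr p * pmf \<mu> k))
      in if S = \<infinity> then \<infinity> else ennreal (enn2real S powr (1 / p)))"

text \<open>
  Ulam--Harris encoding of plane trees: a vertex is the list of child indices (counted from 0, left
  to right) met on the path to it from the root \<open>[]\<close>, so that the children of \<open>u\<close> are
  \<open>u @ [0], u @ [1], \<dots>\<close> and the graph distance from the root to \<open>u\<close> is \<open>length u\<close>.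
  Every rooted, ordered finite tree is encoded by exactly one such set.
\<close>

definition plane_tree :: "nat list set \<Rightarrow> bool" where
  "plane_tree t \<longleftrightarrow> finite t \<and> [] \<in> t \<and>
     (\<forall>u i. u @ [i] \<in> t \<longrightarrow> u \<in> t \<and> (\<forall>j<i. u @ [j] \<in> t))"

definition num_children :: "nat list set \<Rightarrow> nat list \<Rightarrow> nat" where
  "num_children t u = card {i. u @ [i] \<in> t}"

definition ht :: "nat list set \<Rightarrow> nat" where
  "ht t = Max (length ` t)"

text \<open>
  The branching process: the potential individuals are all words, individual \<open>u\<close> has \<open>\<xi> u\<close>
  children, and under \<open>offspring_space \<mu>\<close> the \<open>\<xi> u\<close> are independent with law \<open>\<mu>\<close>.
  The family tree consists of the words that actually occur; it may be infinite.
\<close>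

definition offspring_space :: "nat pmf \<Rightarrow> (nat list \<Rightarrow> nat) measure" where
  "offspring_space \<mu> = PiM UNIV (\<lambda>_. measure_pmf \<mu>)"

definition family_tree :: "(nat list \<Rightarrow> nat) \<Rightarrow> nat list set" where
  "family_tree \<xi> = {u. \<forall>k<length u. u ! k < \<xi> (take k u)}"

text \<open>
  Finiteness is required explicitly since \<open>card\<close> is 0 on infinite sets.
\<close>

definition size_event :: "nat pmf \<Rightarrow> nat \<Rightarrow> (nat list \<Rightarrow> nat) set" where
  "size_event \<mu> n = {\<xi> \<in> space (offspring_space \<mu>).
     finite (family_tree \<xi>) \<and> card (family_tree \<xi>) = n}"

definition attainable_sizes :: "nat pmf \<Rightarrow> nat set" where
  "attainable_sizes \<mu> = {n. measure (offspring_space \<mu>) (size_event \<mu> n) > 0}"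

text \<open>
  The conditional probability given that the family tree has \<open>n\<close> vertices; meaningful for \<open>n\<close>
  in \<open>attainable_sizes \<mu>\<close>.  Under it, \<open>family_tree\<close> is the conditioned tree.
\<close>

definition cond_offspring_space :: "nat pmf \<Rightarrow> nat \<Rightarrow> (nat list \<Rightarrow> nat) measure" where
  "cond_offspring_space \<mu> n = uniform_measure (offspring_space \<mu>) (size_event \<mu> n)"

definition tendsto_in_prob ::
  "('i \<Rightarrow> 'a measure) \<Rightarrow> ('i \<Rightarrow> 'a \<Rightarrow> real) \<Rightarrow> real \<Rightarrow> 'i filter \<Rightarrow> bool" where
  "tendsto_in_prob M X c F \<longleftrightarrow>
     (\<forall>\<epsilon>>0. ((\<lambda>n. measure (M n) {\<omega> \<in> space (M n). \<bar>X n \<omega> - c\<bar> > \<epsilon>}) \<longlongrightarrow> 0) F)"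


lemma prob_space_offspring_space: "prob_space (offspring_space \<mu>)"
  unfolding offspring_space_def by (intro prob_space_PiM measure_pmf.prob_space_axioms)

lemma space_offspring_space [simp]: "space (offspring_space \<mu>) = UNIV"
  by (simp add: offspring_space_def space_PiM)

lemma Nil_in_family_tree [simp]: "[] \<in> family_tree \<xi>"
  by (simp add: family_tree_def)

lemma snoc_in_family_tree [simp]: "u @ [i] \<in> family_tree \<xi> \<longleftrightarrow> u \<in> family_tree \<xi> \<and> i < \<xi> u"
  by (auto simp: family_tree_def nth_append less_Suc_eq)

lemma plane_tree_family_tree: "finite (family_tree \<xi>) \<Longrightarrow> plane_tree (family_tree \<xi>)"
  by (auto simp: plane_tree_def)

lemma num_children_family_tree: "u \<in> family_tree \<xi> \<Longrightarrow> num_children (family_tree \<xi>) u = \<xi> u"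
  by (simp add: num_children_def)

lemma plane_tree_snoc_iff:
  assumes "plane_tree t"
  shows "u @ [i] \<in> t \<longleftrightarrow> u \<in> t \<and> i < num_children t u"
proof -
  let ?A = "{i. u @ [i] \<in> t}"
  have "finite ((\<lambda>i. u @ [i]) -` t)"
    using assms by (intro finite_vimageI) (auto simp: plane_tree_def inj_on_def)
  then have fin: "finite ?A" by (simp add: vimage_def)
  have down: "j \<in> ?A" if "k \<in> ?A" "j < k" for j k
    using assms that by (auto simp: plane_tree_def)
  have eq: "?A = {..<card ?A}"
  proof (cases "?A = {}")
    case False
    have "?A = {..Max ?A}"
      using down[OF Max_in[OF fin False]] Max_in[OF fin False] Max_ge[OF fin]
      by (auto simp del: Max_ge simp: le_less)
    then show ?thesis by (metis card_atMost lessThan_Suc_atMost)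
  qed auto
  have "u \<in> t" if "u @ [i] \<in> t"
    using assms that by (auto simp: plane_tree_def)
  moreover have "u @ [i] \<in> t \<longleftrightarrow> i < num_children t u"
    unfolding num_children_def using eq by blast
  ultimately show ?thesis by blast
qed

lemma family_tree_eq_iff:
  assumes "plane_tree t"
  shows "family_tree \<xi> = t \<longleftrightarrow> (\<forall>u\<in>t. \<xi> u = num_children t u)"
proof
  assume "family_tree \<xi> = t"
  then show "\<forall>u\<in>t. \<xi> u = num_children t u" using num_children_family_tree by metis
next
  assume *: "\<forall>u\<in>t. \<xi> u = num_children t u"
  have "u \<in> family_tree \<xi> \<longleftrightarrow> u \<in> t" for u
  proof (induction u rule: rev_induct)
    case Nil
    then show ?case using assms by (simp add: plane_tree_def)
  next
    case (snoc i u)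
    then show ?case using * by (auto simp: plane_tree_snoc_iff[OF assms])
  qed
  then show "family_tree \<xi> = t" by blast
qed

lemma family_tree_event:
  assumes "plane_tree t"
  shows "{\<xi>. family_tree \<xi> = t} =
    prod_emb UNIV (\<lambda>_. measure_pmf \<mu>) t (PiE t (\<lambda>u. {num_children t u}))"
  by (auto simp: family_tree_eq_iff[OF assms] prod_emb_def PiE_iff)

lemma sets_family_tree_event [measurable]:
  "finite t \<Longrightarrow> {\<xi>. family_tree \<xi> = t} \<in> sets (offspring_space \<mu>)"
proof (cases "plane_tree t")
  case True
  moreover assume "finite t"
  ultimately show ?thesis
    unfolding offspring_space_def family_tree_event[OF True, of \<mu>] by (intro sets_PiM_I) auto
next
  case False
  moreover assume "finite t"
  ultimately have "{\<xi>. family_tree \<xi> = t} = {}" using plane_tree_family_tree by blast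
  then show ?thesis by simp
qed

theorem prob_family_tree_eq:
  assumes "plane_tree t"
  shows "measure (offspring_space \<mu>) {\<xi>. family_tree \<xi> = t} = (\<Prod>u\<in>t. pmf \<mu> (num_children t u))"
proof -
  interpret product_prob_space "\<lambda>_. measure_pmf \<mu>" "UNIV :: nat list set"
    by unfold_locales
  show ?thesis
    unfolding offspring_space_def family_tree_event[OF assms, of \<mu>]
    using assms by (subst measure_PiM_emb) (auto simp: plane_tree_def measure_pmf_single)
qed

lemma sets_family_tree_Collect_finite:
  "{\<xi>. finite (family_tree \<xi>) \<and> P (family_tree \<xi>)} \<in> sets (offspring_space \<mu>)"
proof -
  have "{\<xi>. finite (family_tree \<xi>) \<and> P (family_tree \<xi>)} =
      (\<Union>t\<in>{t. finite t \<and> P t}. {\<xi>. family_tree \<xi> = t})" by auto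
  moreover have "countable {t :: nat list set. finite t \<and> P t}"
    by (rule countable_subset[OF _ countable_Collect_finite]) auto
  ultimately show ?thesis
    by (auto intro!: sets.countable_UN' sets_family_tree_event)
qed

lemma sets_size_event [measurable]: "size_event \<mu> n \<in> sets (offspring_space \<mu>)"
  unfolding size_event_def using sets_family_tree_Collect_finite[of "\<lambda>t. card t = n"] by simp

lemma infinite_length_family_tree:
  assumes "infinite (family_tree \<xi>)"
  shows "infinite (length ` family_tree \<xi>)"
proof
  assume fin: "finite (length ` family_tree \<xi>)"
  have level: "finite {u \<in> family_tree \<xi>. length u = k}" for k
  proof (induction k)
    case (Suc k)
    have "{u \<in> family_tree \<xi>. length u = Suc k} \<subseteq>
        (\<lambda>(u, i). u @ [i]) ` (SIGMA u:{u \<in> family_tree \<xi>. length u = k}. {..<\<xi> u})"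
    proof
      fix v assume v: "v \<in> {u \<in> family_tree \<xi>. length u = Suc k}"
      then obtain u i where "v = u @ [i]" by (cases v rule: rev_cases) auto
      with v show "v \<in> (\<lambda>(u, i). u @ [i]) `
          (SIGMA u:{u \<in> family_tree \<xi>. length u = k}. {..<\<xi> u})"
        by (auto intro!: image_eqI[of _ _ "(u, i)"])
    qed
    then show ?case by (rule finite_subset) (use Suc in auto)
  qed auto
  have "family_tree \<xi> = (\<Union>k\<in>length ` family_tree \<xi>. {u \<in> family_tree \<xi>. length u = k})" by auto
  moreover have "finite \<dots>" using fin level by blast
  ultimately show False using assms by simp
qed

text \<open>
  The height is measurable on the whole space: on infinite trees \<open>Max\<close> takes a constant value.
\<close>

lemma measurable_ht_family_tree [measurable]:
  "(\<lambda>\<xi>. ht (family_tree \<xi>)) \<in> measurable (offspring_space \<mu>) (count_space UNIV)"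
proof -
  obtain c :: nat where c: "\<And>A. infinite A \<Longrightarrow> Max A = c"
    using Max.infinite by metis
  have fin: "{\<xi>. finite (family_tree \<xi>)} \<in> sets (offspring_space \<mu>)"
    using sets_family_tree_Collect_finite[of "\<lambda>_. True"] by simp
  have ht: "ht (family_tree \<xi>) = k \<longleftrightarrow>
      (finite (family_tree \<xi>) \<and> ht (family_tree \<xi>) = k) \<or> (infinite (family_tree \<xi>) \<and> k = c)" for \<xi> k
    using c infinite_length_family_tree by (auto simp: ht_def)
  have "{\<xi>. ht (family_tree \<xi>) = k} \<in> sets (offspring_space \<mu>)" for k
  proof -
    have "{\<xi>. ht (family_tree \<xi>) = k} =
        {\<xi>. finite (family_tree \<xi>) \<and> ht (family_tree \<xi>) = k} \<union>
        (if k = c then space (offspring_space \<mu>) - {\<xi>. finite (family_tree \<xi>)} else {})"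
      using ht[of _ k] by auto
    also have "\<dots> \<in> sets (offspring_space \<mu>)"
      using sets_family_tree_Collect_finite[of "\<lambda>t. ht t = k"] sets.compl_sets[OF fin]
      by (cases "k = c") (simp_all del: space_offspring_space add: sets.Un)
    finally show ?thesis .
  qed
  then show ?thesis
    by (subst measurable_count_space_eq2_countable) (auto simp: vimage_def)
qed

lemma sets_cond_offspring_space [simp, measurable_cong]:
  "sets (cond_offspring_space \<mu> n) = sets (offspring_space \<mu>)"
  by (simp add: cond_offspring_space_def)

lemma prob_space_cond_offspring_space:
  assumes "n \<in> attainable_sizes \<mu>"
  shows "prob_space (cond_offspring_space \<mu> n)"
proof -
  interpret prob_space "offspring_space \<mu>" by (rule prob_space_offspring_space)
  show ?thesis
    unfolding cond_offspring_space_def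
    using assms by (intro prob_space_uniform_measure)
      (auto simp: attainable_sizes_def emeasure_eq_measure)
qed

lemma ht_less_card: "plane_tree t \<Longrightarrow> ht t < card t"
proof -
  assume t: "plane_tree t"
  then have fin: "finite t" and ne: "t \<noteq> {}" by (auto simp: plane_tree_def)
  have "ht t \<in> length ` t"
    unfolding ht_def using fin ne by (intro Max_in) auto
  then obtain u where u: "u \<in> t" "length u = ht t" by force
  have pre: "take (length u - k) u \<in> t" for k
  proof (induction k)
    case (Suc k)
    show ?case
    proof (cases "k < length u")
      case True
      then have "length u - k = Suc (length u - Suc k)" by simp
      with Suc True have "take (length u - Suc k) u @ [u ! (length u - Suc k)] \<in> t"
        by (simp add: take_Suc_conv_app_nth)
      then show ?thesis using t by (auto simp: plane_tree_def)
    next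
      case False
      then show ?thesis using t by (simp add: plane_tree_def)
    qed
  qed (use u in simp)
  have "take k u \<in> t" if "k \<le> length u" for k
    using pre[of "length u - k"] that by simp
  then have "(\<lambda>k. take k u) ` {..length u} \<subseteq> t" by auto
  moreover have "inj_on (\<lambda>k. take k u) {..length u}"
    by (rule inj_on_inverseI[where g = length]) simp
  ultimately have "card {..length u} \<le> card t"
    using fin by (metis card_image card_mono)
  with u show ?thesis by simp
qed

text \<open>
  Hence the Bochner integral in an expectation of a multiple of the height of the conditioned tree
  does not take its default value.
\<close>

lemma integrable_ht_family_tree:
  assumes "n \<in> attainable_sizes \<mu>"
  shows "integrable (cond_offspring_space \<mu> n) (\<lambda>\<xi>. real (ht (family_tree \<xi>)))"
proof -
  interpret prob_space "cond_offspring_space \<mu> n"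
    using assms by (rule prob_space_cond_offspring_space)
  have "AE \<xi> in cond_offspring_space \<mu> n. \<xi> \<in> size_event \<mu> n"
    unfolding cond_offspring_space_def by (rule AE_uniform_measureI) auto
  then have "AE \<xi> in cond_offspring_space \<mu> n. norm (real (ht (family_tree \<xi>))) \<le> real n"
    by eventually_elim
      (auto simp: size_event_def dest!: plane_tree_family_tree ht_less_card)
  then show ?thesis by (rule integrable_const_bound) measurable
qed

end

theory Submission
  imports Defs "HOL-Real_Asymp.Real_Asymp"
begin

unbundle no vec_syntax
unbundle fps_syntax

text \<open>
  Let \<open>S\<close> be the random walk with steps \<open>X - 1\<close>, \<open>X\<close> of law \<open>\<mu>\<close>. By Lagrange inversion, the
  probability that a uniformly random vertex of the conditioned tree has depth at least \<open>h\<close> equals the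
  expectation of \<open>X\<^sub>1 \<cdots> X\<^sub>h\<close> given \<open>S\<^sub>n = -1\<close>. Randomizing \<open>h\<close> binomially with parameters \<open>n\<close> and
  \<open>p \<approx> \<epsilon> / (2 \<surd>n)\<close> turns the product into \<open>\<Prod>i\<le>n. 1 + p (X\<^sub>i - 1)\<close>, which is at most
  \<open>exp (- p\<^sup>2 n A / 8)\<close> unless the truncated empirical variance is below \<open>A / 2\<close>. The latter event has
  exponentially small probability, whereas the probability of \<open>S\<^sub>n = -1\<close> decays subexponentially, because
  \<open>\<mu>\<close> has no exponential moments. As \<open>A\<close> can be taken arbitrarily large, a random vertex has
  depth at least \<open>\<epsilon> \<surd>n\<close> with probability at most \<open>1 / 4\<close> for large \<open>n\<close>.

  The height is controlled by cutting the tree at level \<open>h = \<epsilon> \<surd>n\<close>: it is at most \<open>h\<close> plus the largest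
  height of a subtree at this level. These subtrees are again conditioned trees and have at most
  \<open>n / 4\<close> vertices in total on average, so that the bound \<open>C \<epsilon>\<^sup>2 n\<close> on the second moment of
  the height follows by induction on \<open>n\<close>.
\<close>

subsection \<open>Lagrange inversion\<close>

text \<open>\<open>a ^ k\<close> has no coefficients below \<open>k\<close>, so the sum defining the
  composition extends to the common bound \<open>m\<close> and can be exchanged with the
  convolution.\<close>

lemma fps_compose_mult_nth:
  fixes f a b :: "'a::comm_ring_1 fps"
  assumes "a $ 0 = 0"
  shows "((f oo a) * b) $ m = (\<Sum>k\<le>m. f $ k * (a ^ k * b) $ m)"
proof -
  have "(f oo a) $ j = (\<Sum>k\<le>m. f $ k * a ^ k $ j)" if "j \<le> m" for j
    unfolding fps_compose_nth using that
    by (intro sum.mono_neutral_left) (auto simp: startsby_zero_power_prefix[OF assms, rule_format])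
  then have "((f oo a) * b) $ m = (\<Sum>j=0..m. \<Sum>k\<le>m. f $ k * a ^ k $ j * b $ (m - j))"
    by (simp add: fps_mult_nth sum_distrib_right)
  also have "\<dots> = (\<Sum>k\<le>m. f $ k * (a ^ k * b) $ m)"
    by (subst sum.swap) (simp add: fps_mult_nth sum_distrib_left mult.assoc)
  finally show ?thesis .
qed

lemma fps_X_deriv_nth: "(fps_X * fps_deriv f) $ n = of_nat n * (f $ n :: 'a::comm_ring_1)"
  by (cases n) auto

text \<open>Exchangeability of the steps: given that \<open>Suc m\<close> of them sum to
  \<open>j\<close>, each has conditional mean \<open>j / Suc m\<close>. Formally it is the
  derivative of a power.\<close>

lemma fps_X_deriv_power_nth:
  "of_nat (Suc m) * (fps_X * fps_deriv f * f ^ m) $ j = of_nat j * (f ^ Suc m $ j :: 'a::comm_ring_1)"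
proof -
  have "fps_X * fps_deriv (f ^ Suc m) = of_nat (Suc m) * (fps_X * fps_deriv f * f ^ m)"
    by (simp add: fps_deriv_power' algebra_simps del: power_Suc)
  then have "(fps_X * fps_deriv (f ^ Suc m)) $ j = (of_nat (Suc m) * (fps_X * fps_deriv f * f ^ m)) $ j"
    by simp
  then show ?thesis
    unfolding fps_X_deriv_nth by (simp add: fps_of_nat[symmetric] del: of_nat_Suc power_Suc)
qed

text \<open>The functional equation of the total progeny: a tree is a root together with the trees
  of its children.\<close>

locale tree_fps =
  fixes \<phi> Q :: "real fps"
  assumes Q_eq: "Q = fps_X * (\<phi> oo Q)"
begin

lemma Q_nth_0 [simp]: "Q $ 0 = 0"
  by (subst Q_eq) simp

text \<open>Expands the first tree at its root, which is the first step of the walk. The spectator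
  \<open>b\<close> makes the recursion apply to \<open>Abs_fps (marked_bridge h 0)\<close> as
  well.\<close>

lemma Q_power_mult_nth_Suc:
  "(Q ^ Suc N * b) $ Suc m = (\<Sum>k\<le>m. \<phi> $ k * (Q ^ (N + k) * b) $ m)"
proof -
  have "(Q ^ Suc N * b) $ Suc m = (fps_X * ((\<phi> oo Q) * (Q ^ N * b))) $ Suc m"
    by (subst power_Suc, subst (1) Q_eq) (simp only: mult.assoc)
  also have "\<dots> = ((\<phi> oo Q) * (Q ^ N * b)) $ m" by simp
  also have "\<dots> = (\<Sum>k\<le>m. \<phi> $ k * (Q ^ (N + k) * b) $ m)"
    by (simp add: fps_compose_mult_nth power_add mult.assoc mult.left_commute[of "Q ^ N"])
  finally show ?thesis .
qed

text \<open>The cycle lemma: of the \<open>m\<close> rotations of a word with sum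
  \<open>m - N\<close>, exactly \<open>N\<close> encode a forest of \<open>N\<close> trees. The
  proof instead takes one step at a time; the factor \<open>N' + k\<close> splits the sum into a
  convolution and a derivative, which \<open>fps_X_deriv_power_nth\<close> evaluates.\<close>

lemma kemperman_formula:
  "real m * Q ^ N $ m = (if N \<le> m then real N * \<phi> ^ m $ (m - N) else 0)"
proof (induction m arbitrary: N)
  case (Suc m)
  show ?case
  proof (cases N)
    case (Suc N')
    have rec: "Q ^ N $ Suc m = (\<Sum>k\<le>m. \<phi> $ k * Q ^ (N' + k) $ m)"
      using Q_power_mult_nth_Suc[of N' 1 m] Suc by simp
    show ?thesis
    \<comment> \<open>At \<open>m = 0\<close> the induction hypothesis is void because of its factor
      \<open>m\<close>.\<close>
    proof (cases "m = 0")
      case True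
      then show ?thesis using Suc rec by (cases N') auto
    next
      case False
      show ?thesis
      proof (cases "N' \<le> m")
        case False
        then have "Q ^ (N' + k) $ m = 0" for k
          by (simp add: startsby_zero_power_prefix)
        then show ?thesis using False Suc rec by simp
      next
        case le: True
        define d where "d = m - N'"
        have "real m * Q ^ N $ Suc m = (\<Sum>k\<le>m. \<phi> $ k * (real m * Q ^ (N' + k) $ m))"
          by (simp add: rec sum_distrib_left algebra_simps)
        also have "\<dots> = (\<Sum>k\<le>d. \<phi> $ k * (real (N' + k) * \<phi> ^ m $ (d - k)))"
          unfolding Suc.IH d_def using le by (intro sum.mono_neutral_cong_right) auto
        also have "\<dots> = real N' * (\<Sum>k\<le>d. \<phi> $ k * \<phi> ^ m $ (d - k))
            + (\<Sum>k\<le>d. (real k * \<phi> $ k) * \<phi> ^ m $ (d - k))"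
          by (simp add: sum.distrib sum_distrib_left algebra_simps)
        also have "\<dots> = real N' * \<phi> ^ Suc m $ d + (fps_X * fps_deriv \<phi> * \<phi> ^ m) $ d"
          by (simp add: fps_mult_nth[of \<phi>] fps_mult_nth[of "fps_X * _"] fps_X_deriv_nth
              atLeast0AtMost del: fps_X_mult_nth)
        finally have "real (Suc m) * (real m * Q ^ N $ Suc m)
            = real (Suc m) * real N' * \<phi> ^ Suc m $ d
              + real (Suc m) * (fps_X * fps_deriv \<phi> * \<phi> ^ m) $ d"
          by (simp only: distrib_left mult.assoc)
        also have "\<dots> = (real (Suc m) * real N' + real d) * \<phi> ^ Suc m $ d"
          by (simp only: fps_X_deriv_power_nth distrib_right)
        also have "real (Suc m) * real N' + real d = real m * real N"
          using le by (simp add: d_def Suc of_nat_diff algebra_simps)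
        finally have "real m * (real (Suc m) * Q ^ N $ Suc m) = real m * (real N * \<phi> ^ Suc m $ d)"
          by (simp only: mult_ac)
        then show ?thesis using False le Suc by (simp add: d_def del: power_Suc)
      qed
    qed
  qed simp
qed simp

text \<open>For \<open>X\<close> of law \<open>\<phi>\<close>, this is the expectation of \<open>X\<^sub>1 \<cdots> X\<^sub>h\<close> on the event that the walk with
  steps \<open>X - 1\<close> is at \<open>-(N + 1)\<close> at time \<open>m\<close>. It vanishes for \<open>h = m\<close>, as \<open>h\<close> steps with \<open>X \<ge> 1\<close> do not
  lead below \<open>0\<close>. The condition \<open>N < m\<close> guards against truncated subtraction.\<close>

definition marked_bridge :: "nat \<Rightarrow> nat \<Rightarrow> nat \<Rightarrow> real" where
  "marked_bridge h N m = (if h < m \<and> N < m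
     then ((fps_X * fps_deriv \<phi>) ^ h * \<phi> ^ (m - h)) $ (m - Suc N) else 0)"

lemma marked_bridge_Suc:
  "marked_bridge h (Suc N) (Suc m) = (\<Sum>k\<le>m. \<phi> $ k * marked_bridge h (N + k) m)"
proof (cases "h < m \<and> N < m")
  case True
  let ?P = "(fps_X * fps_deriv \<phi>) ^ h * \<phi> ^ (m - h)"
  have "marked_bridge h (Suc N) (Suc m) = (\<phi> * ?P) $ (m - Suc N)"
    using True by (simp add: marked_bridge_def Suc_diff_le mult_ac)
  also have "\<dots> = (\<Sum>k\<le>m - Suc N. \<phi> $ k * ?P $ (m - Suc N - k))"
    by (simp add: fps_mult_nth atLeast0AtMost)
  also have "\<dots> = (\<Sum>k\<le>m. \<phi> $ k * marked_bridge h (N + k) m)"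
    using True by (intro sum.mono_neutral_cong_left) (auto simp: marked_bridge_def)
  finally show ?thesis .
next
  case False
  \<comment> \<open>The boundary case is \<open>h = m\<close>: only one step is unmarked, and
    \<open>h\<close> marked steps of size at least \<open>1\<close> exceed the total
    \<open>m - Suc N\<close>.\<close>
  have "((fps_X * fps_deriv \<phi>) ^ h * \<phi>) $ j = 0" if "j < h" for j
    unfolding fps_mult_nth using that
    by (intro sum.neutral ballI) (simp add: startsby_zero_power_prefix)
  then have "marked_bridge h (Suc N) (Suc m) = 0"
    using False by (auto simp: marked_bridge_def less_Suc_eq)
  moreover have "(\<Sum>k\<le>m. \<phi> $ k * marked_bridge h (N + k) m) = 0"
    using False by (auto simp: marked_bridge_def)
  ultimately show ?thesis by simp
qed

text \<open>Splits a bridge at its first passage of \<open>-N\<close>. The marked steps carry the factor \<open>k\<close>, so that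
  they can be taken nonnegative; being the last ones, they come after this passage.\<close>

lemma Q_power_mult_marked_bridge:
  "(Q ^ N * Abs_fps (marked_bridge h 0)) $ m = marked_bridge h N m"
proof (induction m arbitrary: N)
  case 0
  then show ?case by (simp add: marked_bridge_def)
next
  case (Suc m)
  show ?case
  proof (cases N)
    case (Suc N')
    then show ?thesis
      by (simp only: Q_power_mult_nth_Suc marked_bridge_Suc Suc.IH)
  qed simp
qed

text \<open>A marked step of size \<open>k + 1\<close> in front of a bridge to
  \<open>-(k + 1)\<close> yields a bridge to \<open>-1\<close> with one more mark. By
  \<open>Q_power_mult_marked_bridge\<close>, the factor \<open>Q ^ k\<close> accounts for the first
  passage of \<open>-k\<close>.\<close>

lemma marked_bridge_step:
  "fps_X * (fps_deriv \<phi> oo Q) * Abs_fps (marked_bridge h 0) = Abs_fps (marked_bridge (Suc h) 0)"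
proof (rule fps_ext)
  fix n
  show "(fps_X * (fps_deriv \<phi> oo Q) * Abs_fps (marked_bridge h 0)) $ n
      = Abs_fps (marked_bridge (Suc h) 0) $ n"
  proof (cases n)
    case 0
    then show ?thesis by (simp add: marked_bridge_def mult.assoc)
  next
    case (Suc m)
    have "(fps_X * (fps_deriv \<phi> oo Q) * Abs_fps (marked_bridge h 0)) $ n
        = (\<Sum>k\<le>m. fps_deriv \<phi> $ k * marked_bridge h k m)"
      using Suc by (simp add: mult.assoc fps_compose_mult_nth Q_power_mult_marked_bridge
          del: fps_deriv_nth)
    also have "\<dots> = marked_bridge (Suc h) 0 n"
    proof (cases "h < m")
      case True
      let ?P = "(fps_X * fps_deriv \<phi>) ^ h * \<phi> ^ (m - h)"
      have "(\<Sum>k\<le>m. fps_deriv \<phi> $ k * marked_bridge h k m)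
          = (\<Sum>k\<le>m - 1. fps_deriv \<phi> $ k * ?P $ (m - 1 - k))"
        using True by (intro sum.mono_neutral_cong_right) (auto simp: marked_bridge_def)
      also have "\<dots> = (fps_deriv \<phi> * ?P) $ (m - 1)"
        by (simp add: fps_mult_nth atLeast0AtMost)
      also have "\<dots> = (fps_X * (fps_deriv \<phi> * ?P)) $ m"
        using True by simp
      also have "\<dots> = marked_bridge (Suc h) 0 n"
        using True Suc by (simp add: marked_bridge_def mult_ac)
      finally show ?thesis .
    qed (auto simp: marked_bridge_def Suc)
    finally show ?thesis by simp
  qed
qed

lemma marked_bridge_0: "Abs_fps (marked_bridge 0 0) = fps_X * fps_deriv Q"
proof (rule fps_ext)
  fix n
  show "Abs_fps (marked_bridge 0 0) $ n = (fps_X * fps_deriv Q) $ n"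
    unfolding fps_X_deriv_nth using kemperman_formula[of n 1] by (cases n) (auto simp: marked_bridge_def)
qed

text \<open>The right side will turn out to count trees with a chosen vertex of depth at least
  \<open>h\<close>: \<open>h\<close> steps down a spine, then a subtree with a chosen vertex. The
  left side is explicit in the walk.\<close>

lemma lagrange_inversion_marked_bridge:
  "Abs_fps (marked_bridge h 0) = (fps_X * (fps_deriv \<phi> oo Q)) ^ h * (fps_X * fps_deriv Q)"
proof (induction h)
  case 0
  then show ?case by (simp add: marked_bridge_0)
next
  case (Suc h)
  then show ?case by (simp add: marked_bridge_step[symmetric] mult.assoc)
qed

end

subsection \<open>Generating functions of plane trees\<close>

text \<open>An inductive copy of the plane trees, on which weights and generating functions can be
  defined by recursion. \<open>vertices\<close> below translates it into sets of words.\<close>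

datatype ptree = Node "ptree list"

fun nodes :: "ptree \<Rightarrow> nat" where
  "nodes (Node ts) = Suc (sum_list (map nodes ts))"

fun height :: "ptree \<Rightarrow> nat" where
  "height (Node ts) = Max (set (0 # map (\<lambda>t. Suc (height t)) ts))"

fun weight :: "real fps \<Rightarrow> ptree \<Rightarrow> real" where
  "weight \<phi> (Node ts) = \<phi> $ length ts * prod_list (map (weight \<phi>) ts)"

text \<open>With \<open>nodes\<close> for \<open>a\<close>, this is the number of vertices of depth
  at least \<open>h\<close>.\<close>

fun level_sum :: "(ptree \<Rightarrow> real) \<Rightarrow> nat \<Rightarrow> ptree \<Rightarrow> real" where
  "level_sum a 0 t = a t"
| "level_sum a (Suc h) (Node ts) = sum_list (map (level_sum a h) ts)"

lemma nodes_pos: "0 < nodes t"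
  by (cases t) simp

lemma nodes_neq_0 [simp]: "nodes t \<noteq> 0"
  by (cases t) simp

lemma length_le_sum_list_nodes: "length ts \<le> sum_list (map nodes ts)"
proof (induction ts)
  case (Cons t ts)
  then show ?case using nodes_pos[of t] by simp
qed simp

lemma nodes_le_sum_list: "t \<in> set ts \<Longrightarrow> nodes t \<le> sum_list (map nodes ts)"
  by (simp add: member_le_sum_list)

lemma finite_nodes: "finite {t. nodes t = n}"
proof (induction n rule: less_induct)
  case (less n)
  have "finite (\<Union>m<n. {t. nodes t = m})" using less by blast
  then have "finite (Node ` {ts. set ts \<subseteq> (\<Union>m<n. {t. nodes t = m}) \<and> length ts \<le> n})"
    by (intro finite_imageI finite_lists_length_le)
  moreover have "t \<in> Node ` {ts. set ts \<subseteq> (\<Union>m<n. {t. nodes t = m}) \<and> length ts \<le> n}"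
    if "nodes t = n" for t
  proof (cases t)
    case (Node ts)
    have "length ts \<le> n" "\<forall>s\<in>set ts. nodes s < n"
      using that Node length_le_sum_list_nodes[of ts] nodes_le_sum_list by (auto simp: less_Suc_eq_le)
    then show ?thesis using Node by blast
  qed
  ultimately show ?case by (auto intro: finite_subset[rotated])
qed

definition forests :: "nat \<Rightarrow> nat \<Rightarrow> ptree list set" where
  "forests N m = {ts. length ts = N \<and> sum_list (map nodes ts) = m}"

lemma forests_0: "forests 0 m = (if m = 0 then {[]} else {})"
  by (auto simp: forests_def)

lemma forests_Suc:
  "forests (Suc N) m = (\<lambda>(j, t, ts). t # ts) ` (SIGMA j:{0..m}. {t. nodes t = j} \<times> forests N (m - j))"
  (is "?L = ?R")
proof
  show "?L \<subseteq> ?R"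
  proof
    fix us assume "us \<in> ?L"
    then obtain t ts where "us = t # ts" "length ts = N" "nodes t + sum_list (map nodes ts) = m"
      by (auto simp: forests_def length_Suc_conv)
    then show "us \<in> ?R"
      by (intro image_eqI[of _ _ "(nodes t, t, ts)"]) (auto simp: forests_def)
  qed
qed (auto simp: forests_def)

lemma finite_forests: "finite (forests N m)"
  by (induction N arbitrary: m) (auto simp: forests_0 forests_Suc finite_nodes)

text \<open>A forest with \<open>m\<close> nodes has at most \<open>m\<close> trees; the bound
  \<open>Suc m\<close> suits the index shift under the derivative in
  \<open>tree_gf_level_sum\<close>.\<close>

lemma sum_nodes_Suc:
  "(\<Sum>t | nodes t = Suc m. f t) = (\<Sum>N\<le>Suc m. \<Sum>ts\<in>forests N m. f (Node ts))"
proof -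
  have "{t. nodes t = Suc m} = Node ` (\<Union>N\<le>Suc m. forests N m)" (is "?L = ?R")
  proof
    show "?L \<subseteq> ?R"
    proof
      fix t assume t: "t \<in> ?L"
      obtain ts where ts: "t = Node ts" by (cases t)
      with t have "ts \<in> forests (length ts) m" "length ts \<le> Suc m"
        using length_le_sum_list_nodes[of ts] by (auto simp: forests_def)
      then show "t \<in> ?R" using ts by blast
    qed
  qed (auto simp: forests_def)
  then have "(\<Sum>t | nodes t = Suc m. f t) = (\<Sum>ts\<in>(\<Union>N\<le>Suc m. forests N m). f (Node ts))"
    by (simp add: sum.reindex inj_on_def)
  also have "\<dots> = (\<Sum>N\<le>Suc m. \<Sum>ts\<in>forests N m. f (Node ts))"
    by (rule sum.UNION_disjoint) (auto simp: finite_forests, auto simp: forests_def)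
  finally show ?thesis .
qed

text \<open>If \<open>\<phi>\<close> is an offspring law, the constant \<open>a = 1\<close> gives
  the probabilities of the tree sizes; dividing by them gives conditional expectations of
  \<open>a\<close>.\<close>

definition tree_gf :: "real fps \<Rightarrow> (ptree \<Rightarrow> real) \<Rightarrow> real fps" where
  "tree_gf \<phi> a = Abs_fps (\<lambda>n. \<Sum>t | nodes t = n. weight \<phi> t * a t)"

definition forest_gf :: "real fps \<Rightarrow> nat \<Rightarrow> (ptree list \<Rightarrow> real) \<Rightarrow> real fps" where
  "forest_gf \<phi> N b =
     Abs_fps (\<lambda>m. \<Sum>ts\<in>forests N m. prod_list (map (weight \<phi>) ts) * b ts)"

lemma tree_gf_nth_0 [simp]: "tree_gf \<phi> a $ 0 = 0"
  by (simp add: tree_gf_def)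

lemma tree_gf_nth_Suc:
  "tree_gf \<phi> a $ Suc m = (\<Sum>N\<le>Suc m. \<phi> $ N * forest_gf \<phi> N (\<lambda>ts. a (Node ts)) $ m)"
  unfolding tree_gf_def forest_gf_def fps_nth_Abs_fps sum_nodes_Suc sum_distrib_left
  by (intro sum.cong) (auto simp: forests_def)

lemma forest_gf_0: "forest_gf \<phi> 0 b = fps_const (b [])"
  by (rule fps_ext) (simp add: forest_gf_def forests_0)

lemma forest_gf_Suc:
  "forest_gf \<phi> (Suc N) (\<lambda>ts. a (hd ts) * b (tl ts)) = tree_gf \<phi> a * forest_gf \<phi> N b"
proof (rule fps_ext)
  fix m
  have inj: "inj_on (\<lambda>(j, t, ts). t # ts) (SIGMA j:{0..m}. {t. nodes t = j} \<times> forests N (m - j))"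
    by (auto simp: inj_on_def)
  let ?W = "\<lambda>ts. prod_list (map (weight \<phi>) ts)"
  have "forest_gf \<phi> (Suc N) (\<lambda>ts. a (hd ts) * b (tl ts)) $ m
      = (\<Sum>(j, t, ts)\<in>(SIGMA j:{0..m}. {t. nodes t = j} \<times> forests N (m - j)).
          weight \<phi> t * a t * (?W ts * b ts))"
    unfolding forest_gf_def fps_nth_Abs_fps forests_Suc sum.reindex[OF inj]
    by (intro sum.cong) (auto simp: mult_ac)
  also have "\<dots> = (\<Sum>j=0..m. \<Sum>(t, ts)\<in>{t. nodes t = j} \<times> forests N (m - j).
          weight \<phi> t * a t * (?W ts * b ts))"
    by (subst sum.Sigma) (simp_all add: finite_nodes finite_forests)
  also have "\<dots> = (tree_gf \<phi> a * forest_gf \<phi> N b) $ m"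
    by (simp add: fps_mult_nth tree_gf_def forest_gf_def sum_product sum.cartesian_product)
  finally show "forest_gf \<phi> (Suc N) (\<lambda>ts. a (hd ts) * b (tl ts)) $ m
      = (tree_gf \<phi> a * forest_gf \<phi> N b) $ m" .
qed

lemma forest_gf_add:
  "forest_gf \<phi> N (\<lambda>ts. b ts + c ts) = forest_gf \<phi> N b + forest_gf \<phi> N c"
  by (rule fps_ext) (simp add: forest_gf_def distrib_left sum.distrib)

lemma forest_gf_cong:
  "(\<And>ts. length ts = N \<Longrightarrow> b ts = c ts) \<Longrightarrow> forest_gf \<phi> N b = forest_gf \<phi> N c"
  by (rule fps_ext) (auto simp: forest_gf_def forests_def)

lemma forest_gf_1: "forest_gf \<phi> N (\<lambda>_. 1) = tree_gf \<phi> (\<lambda>_. 1) ^ N"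
proof (induction N)
  case (Suc N)
  then show ?case using forest_gf_Suc[of \<phi> N "\<lambda>_. 1" "\<lambda>_. 1"] by simp
qed (simp add: forest_gf_0)

text \<open>Each of the \<open>N\<close> trees in turn carries \<open>a\<close>, the others their
  plain weight. The truncated exponent is harmless at \<open>N = 0\<close>, where the factor
  \<open>N\<close> vanishes.\<close>

lemma forest_gf_sum:
  "forest_gf \<phi> N (\<lambda>ts. sum_list (map a ts)) = of_nat N * tree_gf \<phi> (\<lambda>_. 1) ^ (N - 1) * tree_gf \<phi> a"
proof (induction N)
  case (Suc N)
  have "forest_gf \<phi> (Suc N) (\<lambda>ts. sum_list (map a ts))
      = forest_gf \<phi> (Suc N) (\<lambda>ts. a (hd ts) * 1 + 1 * sum_list (map a (tl ts)))"
    by (rule forest_gf_cong) (auto simp: length_Suc_conv)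
  also have "\<dots> = tree_gf \<phi> a * tree_gf \<phi> (\<lambda>_. 1) ^ N + tree_gf \<phi> (\<lambda>_. 1)
      * (of_nat N * tree_gf \<phi> (\<lambda>_. 1) ^ (N - 1) * tree_gf \<phi> a)"
    unfolding forest_gf_add
    using forest_gf_Suc[of \<phi> N a "\<lambda>_. 1"] forest_gf_Suc[of \<phi> N "\<lambda>_. 1" "\<lambda>ts. sum_list (map a ts)"]
    by (simp add: forest_gf_1 Suc)
  also have "\<dots> = of_nat (Suc N) * tree_gf \<phi> (\<lambda>_. 1) ^ (Suc N - 1) * tree_gf \<phi> a"
    by (cases N) (simp_all add: algebra_simps)
  finally show ?case .
qed (simp add: forest_gf_0)

lemma tree_fps_tree_gf: "tree_fps \<phi> (tree_gf \<phi> (\<lambda>_. 1))"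
proof
  let ?Q = "tree_gf \<phi> (\<lambda>_. 1)"
  show "?Q = fps_X * (\<phi> oo ?Q)"
  proof (rule fps_ext)
    fix n
    show "?Q $ n = (fps_X * (\<phi> oo ?Q)) $ n"
    proof (cases n)
      case (Suc m)
      have "?Q ^ Suc m $ m = 0" by (rule startsby_zero_power_prefix[rule_format]) auto
      then show ?thesis
        using Suc by (simp add: tree_gf_nth_Suc forest_gf_1 fps_compose_nth atLeast0AtMost
            del: power_Suc)
    qed simp
  qed
qed

text \<open>Going up one level is a choice among the \<open>N\<close> children of the root, and the
  factors \<open>N * \<phi> $ N\<close> are the coefficients of the derivative of
  \<open>\<phi>\<close>. Iteration gives a spine of length \<open>h\<close>.\<close>

lemma tree_gf_level_sum:
  "tree_gf \<phi> (level_sum a h)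
     = (fps_X * (fps_deriv \<phi> oo tree_gf \<phi> (\<lambda>_. 1))) ^ h * tree_gf \<phi> a"
proof (induction h)
  case 0
  have "level_sum a 0 = a" by auto
  then show ?case by simp
next
  case (Suc h)
  let ?Q = "tree_gf \<phi> (\<lambda>_. 1)" and ?G = "tree_gf \<phi> (level_sum a h)"
  interpret tree_fps \<phi> ?Q by (rule tree_fps_tree_gf)
  have "tree_gf \<phi> (level_sum a (Suc h)) = fps_X * ((fps_deriv \<phi> oo ?Q) * ?G)"
  proof (rule fps_ext)
    fix n
    show "tree_gf \<phi> (level_sum a (Suc h)) $ n = (fps_X * ((fps_deriv \<phi> oo ?Q) * ?G)) $ n"
    proof (cases n)
      case (Suc m)
      have "tree_gf \<phi> (level_sum a (Suc h)) $ n
          = (\<Sum>N\<le>Suc m. \<phi> $ N * (of_nat N * (?Q ^ (N - 1) * ?G) $ m))"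
        unfolding Suc tree_gf_nth_Suc level_sum.simps forest_gf_sum
        by (simp add: fps_of_nat[symmetric] mult.assoc del: sum.atMost_Suc)
      also have "\<dots> = (\<Sum>k\<le>m. fps_deriv \<phi> $ k * (?Q ^ k * ?G) $ m)"
        by (subst sum.atMost_Suc_shift) (simp add: mult_ac)
      also have "\<dots> = (fps_X * ((fps_deriv \<phi> oo ?Q) * ?G)) $ n"
        using Suc by (simp add: fps_compose_mult_nth del: fps_deriv_nth)
      finally show ?thesis .
    qed simp
  qed
  then show ?case by (simp add: Suc mult.assoc)
qed

lemma tree_gf_nodes: "tree_gf \<phi> (\<lambda>t. real (nodes t)) = fps_X * fps_deriv (tree_gf \<phi> (\<lambda>_. 1))"
  by (rule fps_ext) (simp only: fps_X_deriv_nth,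
      simp add: tree_gf_def sum_distrib_left mult_ac)

lemma level_sum_nonneg: "(\<And>t. 0 \<le> a t) \<Longrightarrow> 0 \<le> level_sum a h t"
  by (induction a h t rule: level_sum.induct) (auto intro!: sum_list_nonneg)

lemma level_sum_mono:
  "(\<And>t. a t \<le> b t) \<Longrightarrow> level_sum a h t \<le> level_sum b h t"
  by (induction a h t rule: level_sum.induct) (auto intro!: sum_list_mono)

lemma level_sum_Suc: "level_sum a (Suc h) t = level_sum (level_sum a 1) h t"
proof (induction h arbitrary: t)
  case (Suc h)
  then show ?case by (cases t) (simp add: Suc[abs_def])
qed simp

lemma level_sum_nodes_decreasing:
  "level_sum (\<lambda>t. real (nodes t)) (Suc h) t \<le> level_sum (\<lambda>t. real (nodes t)) h t"
proof -
  have "level_sum (\<lambda>t. real (nodes t)) 1 t \<le> real (nodes t)" for t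
  proof (cases t)
    case (Node ts)
    have "sum_list (map (\<lambda>t. real (nodes t)) ts) = real (sum_list (map nodes ts))"
      by (induction ts) auto
    moreover have "level_sum (\<lambda>t. real (nodes t)) 0 = (\<lambda>t. real (nodes t))" by auto
    ultimately show ?thesis using Node by simp
  qed
  then show ?thesis unfolding level_sum_Suc by (rule level_sum_mono)
qed

lemma height_lt_nodes: "height t < nodes t"
proof (induction t rule: height.induct)
  case (1 ts)
  then show ?case
    using nodes_le_sum_list by (fastforce simp: less_Suc_eq_le Suc_le_eq)
qed

text \<open>A tree higher than \<open>h\<close> attains its height in a subtree rooted at level
  \<open>h\<close>; \<open>m\<close> can be taken as the height of this subtree, whose term is at
  most the whole sum because \<open>g\<close> is nonnegative.\<close>

lemma height_le_level_sum:
  assumes "mono g" and "\<And>m. 0 \<le> g m"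
  shows "height t \<le> h \<or> (\<exists>m. height t \<le> h + m \<and> g m \<le> level_sum (\<lambda>t. g (height t)) h t)"
proof (induction h arbitrary: t)
  case 0
  then show ?case by auto
next
  case (Suc h)
  obtain ts where t: "t = Node ts" by (cases t)
  have "height t \<in> set (0 # map (\<lambda>t. Suc (height t)) ts)"
    unfolding t height.simps by (intro Max_in) auto
  then consider "height t = 0" | s where "s \<in> set ts" "height t = Suc (height s)" by auto
  then show ?case
  proof cases
    case 2
    from Suc[of s] show ?thesis
    proof
      assume "\<exists>m. height s \<le> h + m \<and> g m \<le> level_sum (\<lambda>t. g (height t)) h s"
      then obtain m where m: "height s \<le> h + m" "g m \<le> level_sum (\<lambda>t. g (height t)) h s" by blast
      have "level_sum (\<lambda>t. g (height t)) h s \<le> level_sum (\<lambda>t. g (height t)) (Suc h) t"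
        unfolding t level_sum.simps using 2 assms
        by (intro member_le_sum_list) (auto intro!: level_sum_nonneg)
      then show ?thesis using m 2 by (intro disjI2 exI[of _ m]) auto
    qed (use 2 in auto)
  qed auto
qed

subsection \<open>The family tree as a random plane tree\<close>

fun vertex :: "nat list \<Rightarrow> ptree \<Rightarrow> bool" where
  "vertex [] t = True"
| "vertex (i # u) (Node ts) = (i < length ts \<and> vertex u (ts ! i))"

fun degree_at :: "nat list \<Rightarrow> ptree \<Rightarrow> nat" where
  "degree_at [] (Node ts) = length ts"
| "degree_at (i # u) (Node ts) = degree_at u (ts ! i)"

definition vertices :: "ptree \<Rightarrow> nat list set" where
  "vertices t = {u. vertex u t}"

lemma Nil_in_vertices [simp]: "[] \<in> vertices t"
  by (simp add: vertices_def)

lemma Cons_in_vertices [simp]: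
  "i # u \<in> vertices (Node ts) \<longleftrightarrow> i < length ts \<and> u \<in> vertices (ts ! i)"
  by (simp add: vertices_def)

lemma vertices_Node: "vertices (Node ts) = insert [] (\<Union>i<length ts. (#) i ` vertices (ts ! i))"
proof (rule set_eqI)
  fix u
  show "u \<in> vertices (Node ts) \<longleftrightarrow> u \<in> insert [] (\<Union>i<length ts. (#) i ` vertices (ts ! i))"
    by (cases u) auto
qed

lemma snoc_in_vertices: "u @ [i] \<in> vertices t \<longleftrightarrow> u \<in> vertices t \<and> i < degree_at u t"
proof (induction u arbitrary: t)
  case Nil
  then show ?case by (cases t) simp
next
  case (Cons j u)
  then show ?case by (cases t) auto
qed

lemma finite_vertices [simp]: "finite (vertices t)"
proof (induction t)
  case (Node ts)
  then show ?case by (simp add: vertices_Node)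
qed

lemma plane_tree_vertices: "plane_tree (vertices t)"
  by (auto simp: plane_tree_def snoc_in_vertices)

lemma num_children_vertices: "u \<in> vertices t \<Longrightarrow> num_children (vertices t) u = degree_at u t"
  by (simp add: num_children_def snoc_in_vertices)

lemma prod_vertices_Node:
  "(\<Prod>u\<in>vertices (Node ts). f u) = f [] * (\<Prod>i<length ts. \<Prod>u\<in>vertices (ts ! i). f (i # u))"
proof -
  have "(\<Prod>u\<in>vertices (Node ts). f u) = f [] * (\<Prod>u\<in>(\<Union>i<length ts. (#) i ` vertices (ts ! i)). f u)"
    unfolding vertices_Node by (subst prod.insert) auto
  also have "(\<Prod>u\<in>(\<Union>i<length ts. (#) i ` vertices (ts ! i)). f u)
      = (\<Prod>i<length ts. \<Prod>u\<in>(#) i ` vertices (ts ! i). f u)"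
    by (rule prod.UNION_disjoint) auto
  finally show ?thesis by (simp add: prod.reindex)
qed

lemma weight_eq_prod: "weight \<phi> t = (\<Prod>u\<in>vertices t. \<phi> $ degree_at u t)"
proof (induction t)
  case (Node ts)
  have "prod_list (map (weight \<phi>) ts) = (\<Prod>i<length ts. weight \<phi> (ts ! i))"
    by (simp add: prod.list_conv_set_nth atLeast0LessThan)
  also have "\<dots> = (\<Prod>i<length ts. \<Prod>u\<in>vertices (ts ! i). \<phi> $ degree_at u (ts ! i))"
    using Node by simp
  finally show ?case by (simp add: prod_vertices_Node)
qed

lemma card_vertices: "card (vertices t) = nodes t"
proof (induction t)
  case (Node ts)
  have "card (vertices (Node ts)) = Suc (card (\<Union>i<length ts. (#) i ` vertices (ts ! i)))"
    unfolding vertices_Node by (subst card_insert_disjoint) auto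
  also have "card (\<Union>i<length ts. (#) i ` vertices (ts ! i)) = (\<Sum>i<length ts. card ((#) i ` vertices (ts ! i)))"
    by (rule card_UN_disjoint) auto
  also have "\<dots> = (\<Sum>i<length ts. nodes (ts ! i))"
    using Node by (simp add: card_image)
  finally show ?case by (simp add: sum_list_sum_nth atLeast0LessThan)
qed

lemma ht_vertices: "ht (vertices t) = height t"
proof (induction t)
  case (Node ts)
  have ne: "vertices s \<noteq> {}" for s
    using Nil_in_vertices by blast
  have mx: "Max (length ` vertices s) = height s" if "s \<in> set ts" for s
    using Node that by (simp add: ht_def)
  have len: "length ` vertices (Node ts)
      = insert 0 (\<Union>i<length ts. Suc ` length ` vertices (ts ! i))"
    by (auto simp: vertices_Node image_UN image_image)
  have mS: "Max (Suc ` length ` vertices s) = Suc (height s)" if "s \<in> set ts" for s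
    using mx[OF that] ne[of s] by (subst mono_Max_commute[symmetric]) (auto simp: mono_def)
  have "Max (length ` vertices (Node ts)) = height (Node ts)"
  proof (rule Max_eqI)
    show "finite (length ` vertices (Node ts))" by simp
  next
    fix y assume "y \<in> length ` vertices (Node ts)"
    then consider "y = 0" | i where "i < length ts" "y \<in> Suc ` length ` vertices (ts ! i)"
      unfolding len by auto
    then show "y \<le> height (Node ts)"
    proof cases
      case 2
      have "y \<le> Suc (height (ts ! i))"
        using 2 mS[of "ts ! i"] Max_ge[of "Suc ` length ` vertices (ts ! i)" y] by simp
      also have "\<dots> \<le> height (Node ts)"
        using 2 by (simp del: Max_insert)
      finally show ?thesis .
    qed simp
  next
    have "height (Node ts) \<in> set (0 # map (\<lambda>t. Suc (height t)) ts)"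
      unfolding height.simps by (intro Max_in) auto
    then consider "height (Node ts) = 0" | i where "i < length ts" "height (Node ts) = Suc (height (ts ! i))"
      by (auto simp: in_set_conv_nth)
    then show "height (Node ts) \<in> length ` vertices (Node ts)"
    proof cases
      case 2
      have "Max (Suc ` length ` vertices (ts ! i)) \<in> Suc ` length ` vertices (ts ! i)"
        using ne by (intro Max_in) auto
      then show ?thesis using 2 mS[of "ts ! i"] unfolding len by auto
    qed (simp add: len)
  qed
  then show ?case by (simp add: ht_def)
qed

lemma inj_vertices: "vertices s = vertices t \<Longrightarrow> s = t"
proof (induction s arbitrary: t)
  case (Node ss)
  obtain ts where t: "t = Node ts" by (cases t)
  have mem: "i < length ss \<and> u \<in> vertices (ss ! i) \<longleftrightarrow> i < length ts \<and> u \<in> vertices (ts ! i)" for i u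
    using Node.prems unfolding t by (metis Cons_in_vertices)
  have "i < length ss \<longleftrightarrow> i < length ts" for i
    using mem[of i "[]"] by simp
  then have len: "length ss = length ts"
    by (metis linorder_neqE_nat less_irrefl)
  have "ss ! i = ts ! i" if "i < length ss" for i
  proof (rule Node.IH)
    show "vertices (ss ! i) = vertices (ts ! i)" using mem[of i] that len by auto
  qed (use that in simp)
  then show ?case using len t by (simp add: list_eq_iff_nth_eq)
qed

lemma plane_tree_Cons: "plane_tree t \<Longrightarrow> i # u \<in> t \<Longrightarrow> [i] \<in> t"
proof (induction u rule: rev_induct)
  case (snoc j u)
  have "(i # u) @ [j] \<in> t" using snoc.prems by simp
  then have "i # u \<in> t" using snoc.prems unfolding plane_tree_def by blast
  then show ?case using snoc by blast
qed

text \<open>The words behind a first letter \<open>i\<close> form a plane tree with fewer vertices,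
  as the root is missing, so induction on the cardinality yields the subtree of each child.\<close>

lemma plane_tree_eq_vertices: "plane_tree t \<Longrightarrow> \<exists>s. t = vertices s"
proof (induction "card t" arbitrary: t rule: less_induct)
  case less
  define k where "k = num_children t []"
  have root: "[i] \<in> t \<longleftrightarrow> i < k" for i
    using plane_tree_snoc_iff[OF less.prems, of "[]" i] less.prems by (auto simp: plane_tree_def k_def)
  have "\<exists>s. {u. i # u \<in> t} = vertices s" if i: "i < k" for i
  proof -
    let ?ti = "{u. i # u \<in> t}"
    have fin: "finite t" using less.prems by (simp add: plane_tree_def)
    have "finite ((#) i -` t)" using fin by (intro finite_vimageI) auto
    then have fi: "finite ?ti" by (simp add: vimage_def)
    have "plane_tree ?ti"
      unfolding plane_tree_def
    proof (intro conjI allI impI)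
      fix u j assume "u @ [j] \<in> ?ti"
      then have "(i # u) @ [j] \<in> t" by simp
      then have "i # u \<in> t" "\<And>l. l < j \<Longrightarrow> (i # u) @ [l] \<in> t"
        using less.prems unfolding plane_tree_def by blast+
      then show "u \<in> ?ti" "\<And>l. l < j \<Longrightarrow> u @ [l] \<in> ?ti" by auto
    qed (use root i fi in auto)
    moreover have "card ?ti < card t"
    proof -
      have "card ?ti = card ((#) i ` ?ti)" by (simp add: card_image)
      also have "\<dots> < card t"
        using less.prems by (intro psubset_card_mono fin) (auto simp: plane_tree_def)
      finally show ?thesis .
    qed
    ultimately show ?thesis using less.hyps by blast
  qed
  then obtain s where s: "\<And>i. i < k \<Longrightarrow> {u. i # u \<in> t} = vertices (s i)" by metis
  have "u \<in> t \<longleftrightarrow> u \<in> vertices (Node (map s [0..<k]))" for u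
  proof (cases u)
    case Nil
    then show ?thesis using less.prems by (simp add: plane_tree_def)
  next
    case (Cons i v)
    then show ?thesis using s[of i] plane_tree_Cons[OF less.prems] root by auto
  qed
  then show ?case by blast
qed

definition offspring_fps :: "nat pmf \<Rightarrow> real fps" where
  "offspring_fps \<mu> = Abs_fps (pmf \<mu>)"

lemma offspring_fps_nth [simp]: "offspring_fps \<mu> $ k = pmf \<mu> k"
  by (simp add: offspring_fps_def)

lemma prob_family_tree_vertices:
  "measure (offspring_space \<mu>) {\<xi>. family_tree \<xi> = vertices t} = weight (offspring_fps \<mu>) t"
  by (simp add: prob_family_tree_eq[OF plane_tree_vertices] weight_eq_prod num_children_vertices)

lemma size_event_eq: "size_event \<mu> n = (\<Union>t\<in>{t. nodes t = n}. {\<xi>. family_tree \<xi> = vertices t})"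
proof -
  have "\<exists>t. nodes t = card (family_tree \<xi>) \<and> family_tree \<xi> = vertices t" if "finite (family_tree \<xi>)" for \<xi>
    using plane_tree_eq_vertices[OF plane_tree_family_tree[OF that]] card_vertices by metis
  then show ?thesis by (auto simp: size_event_def card_vertices)
qed

lemma measure_size_event:
  "measure (offspring_space \<mu>) (size_event \<mu> n) = (\<Sum>t | nodes t = n. weight (offspring_fps \<mu>) t)"
proof -
  interpret prob_space "offspring_space \<mu>" by (rule prob_space_offspring_space)
  have "measure (offspring_space \<mu>) (size_event \<mu> n)
      = (\<Sum>t | nodes t = n. measure (offspring_space \<mu>) {\<xi>. family_tree \<xi> = vertices t})"
    unfolding size_event_eq
    by (rule measure_finite_Union)
      (auto simp: finite_nodes disjoint_family_on_def emeasure_eq_measure dest: inj_vertices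
        intro!: sets_family_tree_event)
  then show ?thesis by (simp add: prob_family_tree_vertices)
qed

text \<open>Under the conditioned measure the family tree is almost surely one of finitely many sets
  \<open>vertices t\<close>, so the integrand agrees almost everywhere with a finite combination of
  indicators.\<close>

lemma expectation_cond_family_tree:
  assumes "n \<in> attainable_sizes \<mu>"
    and f: "(\<lambda>\<xi>. f (family_tree \<xi>)) \<in> borel_measurable (offspring_space \<mu>)"
  shows "(\<integral>\<xi>. f (family_tree \<xi>) \<partial>cond_offspring_space \<mu> n :: real)
    = (\<Sum>t | nodes t = n. weight (offspring_fps \<mu>) t * f (vertices t))
      / (\<Sum>t | nodes t = n. weight (offspring_fps \<mu>) t)"
proof -
  let ?M = "cond_offspring_space \<mu> n" and ?E = "\<lambda>t. {\<xi>. family_tree \<xi> = vertices t}"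
  interpret O: prob_space "offspring_space \<mu>" by (rule prob_space_offspring_space)
  interpret prob_space ?M using assms(1) by (rule prob_space_cond_offspring_space)
  have meas: "?E t \<in> sets ?M" for t
    by (simp add: sets_family_tree_event)
  have "measure ?M (?E t) = weight (offspring_fps \<mu>) t / measure (offspring_space \<mu>) (size_event \<mu> n)"
    if "nodes t = n" for t
  proof -
    have "size_event \<mu> n \<inter> ?E t = ?E t" using that by (auto simp: size_event_eq)
    then show ?thesis
      unfolding cond_offspring_space_def using assms
      by (subst measure_uniform_measure)
        (auto simp: attainable_sizes_def O.emeasure_eq_measure sets_family_tree_event
          prob_family_tree_vertices)
  qed
  note prob = this
  have "AE \<xi> in ?M. \<xi> \<in> size_event \<mu> n"
    unfolding cond_offspring_space_def by (rule AE_uniform_measureI) auto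
  then have "AE \<xi> in ?M. f (family_tree \<xi>) = (\<Sum>t | nodes t = n. f (vertices t) * indicator (?E t) \<xi>)"
  proof eventually_elim
    case (elim \<xi>)
    then obtain s where s: "nodes s = n" "family_tree \<xi> = vertices s" by (auto simp: size_event_eq)
    have "(\<Sum>t | nodes t = n. f (vertices t) * indicator (?E t) \<xi>)
        = (\<Sum>t | nodes t = n. if t = s then f (vertices t) else 0)"
      using s by (intro sum.cong) (auto simp: indicator_def dest: inj_vertices)
    then show ?case using s by (simp add: finite_nodes)
  qed
  then have "(\<integral>\<xi>. f (family_tree \<xi>) \<partial>?M)
      = (\<integral>\<xi>. (\<Sum>t | nodes t = n. f (vertices t) * indicator (?E t) \<xi>) \<partial>?M)"
    using f meas by (intro integral_cong_AE)
      (auto cong: measurable_cong_sets simp: measurable_cong_sets[OF sets_cond_offspring_space refl])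
  also have "\<dots> = (\<Sum>t | nodes t = n. f (vertices t) * measure ?M (?E t))"
    using meas by (subst Bochner_Integration.integral_sum) (auto simp: emeasure_eq_measure)
  also have "\<dots> = (\<Sum>t | nodes t = n. weight (offspring_fps \<mu>) t * f (vertices t)
      / measure (offspring_space \<mu>) (size_event \<mu> n))"
    by (intro sum.cong) (auto simp: prob)
  finally show ?thesis by (simp add: measure_size_event sum_divide_distrib)
qed

subsection \<open>Estimates for bridges\<close>

definition words :: "nat \<Rightarrow> nat \<Rightarrow> nat list set" where
  "words n m = {xs. length xs = n \<and> sum_list xs = m}"

lemma words_Suc: "words (Suc n) m = (\<lambda>(i, xs). i # xs) ` (SIGMA i:{0..m}. words n (m - i))"
  (is "?L = ?R")
proof
  show "?L \<subseteq> ?R"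
  proof
    fix xs assume "xs \<in> ?L"
    then obtain i ys where "xs = i # ys" "length ys = n" "i + sum_list ys = m"
      by (auto simp: words_def length_Suc_conv)
    then show "xs \<in> ?R" by (intro image_eqI[of _ _ "(i, ys)"]) (auto simp: words_def)
  qed
qed (auto simp: words_def)

lemma finite_words: "finite (words n m)"
proof (induction n arbitrary: m)
  case 0
  have "words 0 m \<subseteq> {[]}" by (auto simp: words_def)
  then show ?case by (rule finite_subset) simp
qed (auto simp: words_Suc)

text \<open>Expands the coefficient over the paths of the walk, so that inequalities can be proved
  path by path.\<close>

lemma fps_power_nth_words:
  fixes f :: "'a::comm_ring_1 fps"
  shows "f ^ n $ m = (\<Sum>xs\<in>words n m. \<Prod>x\<leftarrow>xs. f $ x)"
proof (induction n arbitrary: m)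
  case 0
  have "words 0 m = (if m = 0 then {[]} else {})" by (auto simp: words_def)
  then show ?case by simp
next
  case (Suc n)
  have inj: "inj_on (\<lambda>(i, xs). i # xs) (SIGMA i:{0..m}. words n (m - i))"
    by (auto simp: inj_on_def)
  have "(\<Sum>xs\<in>words (Suc n) m. \<Prod>x\<leftarrow>xs. f $ x)
      = (\<Sum>(i, xs)\<in>(SIGMA i:{0..m}. words n (m - i)). f $ i * (\<Prod>x\<leftarrow>xs. f $ x))"
    unfolding words_Suc sum.reindex[OF inj] by (intro sum.cong) auto
  also have "\<dots> = (\<Sum>i=0..m. \<Sum>xs\<in>words n (m - i). f $ i * (\<Prod>x\<leftarrow>xs. f $ x))"
    by (subst sum.Sigma) (simp_all add: finite_words)
  finally show ?case by (simp add: fps_mult_nth Suc sum_distrib_left)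
qed

section \<open>Power series with nonnegative coefficients\<close>

definition fps_nonneg :: "real fps \<Rightarrow> bool" where
  "fps_nonneg f \<longleftrightarrow> (\<forall>n. 0 \<le> f $ n)"

lemma fps_nonnegD: "fps_nonneg f \<Longrightarrow> 0 \<le> f $ n"
  by (simp add: fps_nonneg_def)

lemma fps_nonneg_mult: "fps_nonneg f \<Longrightarrow> fps_nonneg g \<Longrightarrow> fps_nonneg (f * g)"
  by (auto simp: fps_nonneg_def fps_mult_nth intro!: sum_nonneg)

lemma fps_nonneg_power: "fps_nonneg f \<Longrightarrow> fps_nonneg (f ^ n)"
proof (induction n)
  case 0
  then show ?case by (simp add: fps_nonneg_def)
qed (simp add: fps_nonneg_mult)

lemma fps_nonneg_X_deriv: "fps_nonneg f \<Longrightarrow> fps_nonneg (fps_X * fps_deriv f)"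
  unfolding fps_nonneg_def fps_X_deriv_nth by simp

lemma fps_mult_nth_ge:
  assumes "fps_nonneg f" "fps_nonneg g"
  shows "f $ i * g $ j \<le> (f * g) $ (i + j)"
proof -
  have "f $ i * g $ (i + j - i) \<le> (\<Sum>k=0..i + j. f $ k * g $ (i + j - k))"
    using assms by (intro member_le_sum) (auto simp: fps_nonneg_def)
  then show ?thesis by (simp add: fps_mult_nth)
qed

lemma fps_power_nth_ge:
  assumes "fps_nonneg f"
  shows "(f $ i) ^ n \<le> f ^ n $ (n * i)"
proof (induction n)
  case (Suc n)
  have "(f $ i) ^ Suc n \<le> f $ i * f ^ n $ (n * i)"
    using Suc assms by (auto intro: mult_left_mono fps_nonnegD)
  also have "\<dots> \<le> f ^ Suc n $ (Suc n * i)"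
    using fps_mult_nth_ge[OF assms fps_nonneg_power[OF assms], of i n "n * i"] by (simp add: mult.commute)
  finally show ?case .
qed simp

lemma sum_fps_mult_le:
  assumes "fps_nonneg f" "fps_nonneg g" "(\<Sum>i\<le>m. f $ i) \<le> a" "(\<Sum>i\<le>m. g $ i) \<le> b"
  shows "(\<Sum>i\<le>m. (f * g) $ i) \<le> a * b"
proof -
  have "(\<Sum>i\<le>m. (f * g) $ i) = (\<Sum>k\<le>m. \<Sum>i\<le>k. f $ i * g $ (k - i))"
    by (simp add: fps_mult_nth atLeast0AtMost)
  also have "\<dots> = (\<Sum>(i, j)\<in>{(i, j). i + j \<le> m}. f $ i * g $ j)"
    by (rule sum.triangle_reindex_eq[symmetric])
  also have "\<dots> \<le> (\<Sum>(i, j)\<in>{..m} \<times> {..m}. f $ i * g $ j)"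
    using assms by (intro sum_mono2) (auto simp: fps_nonneg_def)
  also have "\<dots> = (\<Sum>i\<le>m. f $ i) * (\<Sum>i\<le>m. g $ i)"
    by (simp add: sum_product sum.cartesian_product)
  also have "\<dots> \<le> a * b"
    using assms by (intro mult_mono) (auto intro!: sum_nonneg order_trans[OF sum_nonneg assms(3)] dest: fps_nonnegD)
  finally show ?thesis .
qed

lemma sum_fps_power_le:
  assumes "fps_nonneg f" "(\<Sum>i\<le>m. f $ i) \<le> a"
  shows "(\<Sum>i\<le>m. f ^ n $ i) \<le> a ^ n"
proof (induction n)
  case 0
  have "(\<Sum>i\<le>m. (1 :: real fps) $ i) = (\<Sum>i\<le>m. if i = 0 then 1 else 0)"
    by (intro sum.cong) auto
  then show ?case by simp
next
  case (Suc n)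
  then show ?case using assms by (simp add: sum_fps_mult_le fps_nonneg_power)
qed

lemma fps_power_nth_le:
  assumes "fps_nonneg f" "(\<Sum>i\<le>m. f $ i) \<le> a"
  shows "f ^ n $ m \<le> a ^ n"
proof -
  have "f ^ n $ m \<le> (\<Sum>i\<le>m. f ^ n $ i)"
    using fps_nonneg_power[OF assms(1)] by (intro member_le_sum) (auto simp: fps_nonneg_def)
  then show ?thesis using sum_fps_power_le[OF assms, of n] by linarith
qed

lemma prod_list_le_exp:
  fixes f g e :: "'a \<Rightarrow> real"
  assumes "\<And>x. 0 \<le> f x" "\<And>x. f x \<le> g x * exp (e x)"
  shows "(\<Prod>x\<leftarrow>xs. f x) \<le> (\<Prod>x\<leftarrow>xs. g x) * exp (\<Sum>x\<leftarrow>xs. e x)"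
proof (induction xs)
  case (Cons x xs)
  have "0 \<le> (\<Prod>x\<leftarrow>xs. f x)" for xs using assms(1) by (induction xs) auto
  then have "f x * (\<Prod>x\<leftarrow>xs. f x) \<le> (g x * exp (e x)) * ((\<Prod>x\<leftarrow>xs. g x) * exp (\<Sum>x\<leftarrow>xs. e x))"
    using assms Cons by (intro mult_mono) (auto intro: order_trans)
  then show ?case by (simp add: exp_add mult_ac)
qed simp

text \<open>The term \<open>y\<^sup>2 / 4\<close> is the gain from the variance. With
  \<open>z = y - y\<^sup>2 / 4\<close> one has \<open>z \<ge> 3 / 4 * y\<close>, so
  \<open>z\<^sup>2 / 2\<close> makes up for \<open>y\<^sup>2 / 4\<close> in
  \<open>1 + z + z\<^sup>2 / 2 \<le> exp z\<close>.\<close>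

lemma one_plus_le_exp_minus_square:
  fixes y :: real
  assumes "0 \<le> y" "y \<le> 1"
  shows "1 + y \<le> exp (y - y\<^sup>2 / 4)"
proof -
  define z where "z = y - y\<^sup>2 / 4"
  have y2: "y\<^sup>2 \<le> y" using assms by (simp add: power2_eq_square mult_left_le)
  then have z: "3 / 4 * y \<le> z" by (simp add: z_def)
  then have "(3 / 4 * y)\<^sup>2 \<le> z\<^sup>2" using assms by (intro power_mono) auto
  then have "9 / 16 * y\<^sup>2 \<le> z\<^sup>2" by (simp add: power_mult_distrib power2_eq_square)
  moreover have "z = y - y\<^sup>2 / 4" "0 \<le> y\<^sup>2" by (simp_all add: z_def)
  ultimately have "1 + y \<le> 1 + z + z\<^sup>2 / 2" by linarith
  also have "\<dots> \<le> exp z"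
    using z assms by (intro exp_lower_Taylor_quadratic) auto
  finally show ?thesis by (simp add: z_def)
qed

text \<open>The product of the right side with \<open>1 + y + y\<^sup>2 / 2\<close>, a lower bound
  of \<open>exp y\<close>, is \<open>1 + (y\<^sup>2 / 2)\<^sup>2\<close>, hence at least
  \<open>1\<close>.\<close>

lemma exp_minus_le_quadratic:
  fixes y :: real
  assumes "0 \<le> y"
  shows "exp (- y) \<le> 1 - y + y\<^sup>2 / 2"
proof -
  have nn: "0 < 1 - y + y\<^sup>2 / 2"
    using zero_le_power2[of "y - 1"] by (simp add: power2_diff)
  have "(1 - y + y\<^sup>2 / 2) * (1 + y + y\<^sup>2 / 2) = 1 + (y\<^sup>2 / 2)\<^sup>2"
    by (simp add: field_simps power2_eq_square)
  then have "1 \<le> (1 - y + y\<^sup>2 / 2) * (1 + y + y\<^sup>2 / 2)" by simp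
  also have "\<dots> \<le> (1 - y + y\<^sup>2 / 2) * exp y"
    using nn assms by (intro mult_left_mono exp_lower_Taylor_quadratic) auto
  finally show ?thesis by (simp add: exp_minus field_simps)
qed

text \<open>What the estimates take from the offspring law. The condition
  \<open>subexponential\<close>, a consequence of the infinite second moment, provides arbitrarily
  large \<open>k\<close> of mass at least \<open>exp (- \<eta> * k)\<close>, for any rate
  \<open>\<eta>\<close>.\<close>

locale infinite_variance_offspring =
  fixes \<phi> :: "real fps"
  assumes nonneg: "0 \<le> \<phi> $ k"
    and sums_1: "(\<lambda>k. \<phi> $ k) sums 1"
    and mean_le: "(\<Sum>k\<le>m. real k * \<phi> $ k) \<le> 1"
    and nth_0_pos: "0 < \<phi> $ 0"
    and truncated_variance_unbounded:
      "\<exists>K. C \<le> (\<Sum>k=2..K. \<phi> $ k * (real k - 1)\<^sup>2)"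
    and subexponential: "0 < \<eta> \<Longrightarrow> \<exists>k\<ge>k0. exp (- \<eta> * real k) \<le> \<phi> $ k"
begin

lemma fps_nonneg: "fps_nonneg \<phi>"
  by (simp add: fps_nonneg_def nonneg)

lemma sum_nth_le_1: "(\<Sum>k\<le>m. \<phi> $ k) \<le> 1"
  using sum_le_suminf[of "\<lambda>k. \<phi> $ k" "{..m}"] sums_1 nonneg by (simp add: sums_iff)

lemma power_nonneg: "0 \<le> \<phi> ^ n $ m"
  by (intro fps_nonnegD fps_nonneg_power fps_nonneg)

lemma power_sums_1: "(\<lambda>k. \<phi> ^ n $ k) sums 1"
proof (induction n)
  case 0
  have "(\<lambda>k. (1 :: real fps) $ k) sums (\<Sum>k\<in>{0}. 1 $ k)" by (rule sums_finite) auto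
  then show ?case by simp
next
  case (Suc n)
  have "summable (\<lambda>k. norm (\<phi> $ k))" "summable (\<lambda>k. norm (\<phi> ^ n $ k))"
    using sums_1 Suc nonneg power_nonneg by (auto simp: sums_iff)
  from Cauchy_product_sums[OF this] show ?case
    using sums_1 Suc by (simp add: sums_iff fps_mult_nth atLeast0AtMost)
qed

lemma power_mean_le: "(\<Sum>k\<le>m. real k * \<phi> ^ n $ k) \<le> real n"
proof (cases n)
  case 0
  then show ?thesis by (auto intro!: sum_nonpos)
next
  case (Suc l)
  have "real k * \<phi> ^ n $ k = real n * (fps_X * fps_deriv \<phi> * \<phi> ^ l) $ k" for k
    using fps_X_deriv_power_nth[of l \<phi> k] Suc by simp
  then have "(\<Sum>k\<le>m. real k * \<phi> ^ n $ k) = real n * (\<Sum>k\<le>m. (fps_X * fps_deriv \<phi> * \<phi> ^ l) $ k)"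
    by (simp add: sum_distrib_left)
  also have "\<dots> \<le> real n * (1 * 1 ^ l)"
  proof (intro mult_left_mono sum_fps_mult_le fps_nonneg_X_deriv fps_nonneg_power fps_nonneg
        sum_fps_power_le sum_nth_le_1)
    show "(\<Sum>k\<le>m. (fps_X * fps_deriv \<phi>) $ k) \<le> 1"
      unfolding fps_X_deriv_nth by (rule mean_le)
  qed simp
  finally show ?thesis by simp
qed

text \<open>Markov's inequality for the sum of \<open>n\<close> steps, whose mean is at most
  \<open>n\<close>; it is shown for partial sums up to \<open>L\<close>, then \<open>L\<close> tends
  to infinity.\<close>

lemma power_markov: "1 - real n / real (Suc M) \<le> (\<Sum>k\<le>M. \<phi> ^ n $ k)"
proof -
  have "(\<Sum>k\<le>L. \<phi> ^ n $ k) \<le> (\<Sum>k\<le>M. \<phi> ^ n $ k) + real n / real (Suc M)" for L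
  proof -
    have "(\<Sum>k\<le>L. \<phi> ^ n $ k) \<le> (\<Sum>k\<in>{..M} \<union> {Suc M..L}. \<phi> ^ n $ k)"
      by (intro sum_mono2) (auto simp: power_nonneg)
    also have "\<dots> = (\<Sum>k\<le>M. \<phi> ^ n $ k) + (\<Sum>k=Suc M..L. \<phi> ^ n $ k)"
      by (intro sum.union_disjoint) auto
    also have "(\<Sum>k=Suc M..L. \<phi> ^ n $ k) \<le> (\<Sum>k=Suc M..L. real k * \<phi> ^ n $ k / real (Suc M))"
    proof (rule sum_mono)
      fix k assume "k \<in> {Suc M..L}"
      then have "real (Suc M) * \<phi> ^ n $ k \<le> real k * \<phi> ^ n $ k"
        by (intro mult_right_mono power_nonneg) auto
      then show "\<phi> ^ n $ k \<le> real k * \<phi> ^ n $ k / real (Suc M)"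
        by (simp add: field_simps)
    qed
    also have "\<dots> \<le> (\<Sum>k\<le>L. real k * \<phi> ^ n $ k / real (Suc M))"
      by (intro sum_mono2) (auto simp: power_nonneg)
    also have "\<dots> \<le> real n / real (Suc M)"
      unfolding sum_divide_distrib[symmetric] by (intro divide_right_mono power_mean_le) auto
    finally show ?thesis by simp
  qed
  moreover have "(\<lambda>L. \<Sum>k\<le>L. \<phi> ^ n $ k) \<longlonglongrightarrow> 1"
    using power_sums_1 by (simp add: sums_def_le)
  ultimately have "1 \<le> (\<Sum>k\<le>M. \<phi> ^ n $ k) + real n / real (Suc M)"
    by (intro LIMSEQ_le_const2) auto
  then show ?thesis by simp
qed

lemma power_nth_add: "\<phi> ^ n $ i * \<phi> ^ m $ j \<le> \<phi> ^ (n + m) $ (i + j)"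
  unfolding power_add by (intro fps_mult_nth_ge fps_nonneg_power fps_nonneg)

text \<open>One representative is fixed for each of the finitely many residues that occur, which
  makes \<open>L\<close>, \<open>T\<close> and \<open>\<delta>\<close> uniform in the word to be
  replaced.\<close>

lemma residue_representatives:
  assumes "0 < k"
  obtains L T \<delta> where "0 < \<delta>" "\<And>l t. 0 < \<phi> ^ l $ t \<Longrightarrow>
    \<exists>l' t'. l' \<le> L \<and> t' \<le> T \<and> \<delta> \<le> \<phi> ^ l' $ t' \<and> t' mod k = t mod k"
proof -
  define R where "R = {c. c < k \<and> (\<exists>l t. 0 < \<phi> ^ l $ t \<and> t mod k = c)}"
  have "finite R" by (auto simp: R_def)
  have "\<forall>c\<in>R. \<exists>l t. 0 < \<phi> ^ l $ t \<and> t mod k = c" by (auto simp: R_def)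
  then obtain l t where lt: "\<And>c. c \<in> R \<Longrightarrow> 0 < \<phi> ^ l c $ t c \<and> t c mod k = c" by metis
  define \<delta> where "\<delta> = Min (insert 1 ((\<lambda>c. \<phi> ^ l c $ t c) ` R))"
  show thesis
  proof (rule that[of \<delta> "Max (insert 0 (l ` R))" "Max (insert 0 (t ` R))"])
    show "0 < \<delta>" using \<open>finite R\<close> lt by (auto simp: \<delta>_def)
  next
    fix l' t' assume pos: "0 < \<phi> ^ l' $ t'"
    define c where "c = t' mod k"
    have c: "c \<in> R" using pos assms by (auto simp: R_def c_def)
    then have "l c \<le> Max (insert 0 (l ` R))" "t c \<le> Max (insert 0 (t ` R))" "\<delta> \<le> \<phi> ^ l c $ t c"
      using \<open>finite R\<close> by (auto simp: \<delta>_def intro!: Max_ge Min_le)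
    then show "\<exists>l' ta. l' \<le> Max (insert 0 (l ` R)) \<and> ta \<le> Max (insert 0 (t ` R)) \<and>
        \<delta> \<le> \<phi> ^ l' $ ta \<and> ta mod k = t' mod k"
      using lt[OF c] by (auto simp: c_def)
  qed
qed

end

section \<open>Lower and upper bounds for bridge probabilities\<close>

context infinite_variance_offspring
begin

text \<open>Run \<open>n - r\<close> steps with \<open>r \<approx> 2 e n\<close>. By Markov's inequality their sum is some \<open>s \<le> (1 - e) n\<close> with
  probability at least \<open>e / (n + 1)\<close>. The last \<open>r\<close> steps have to make up the remaining \<open>n - 1 - s\<close>: a bounded
  word adjusts the residue modulo \<open>k\<close>, at most \<open>n / k\<close> jumps of a single large size \<open>k\<close>, each of
  probability at least \<open>exp (- e k)\<close>, do the rest, and zeros fill up. The residue is attainable because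
  \<open>n - 1 - s\<close> is congruent to \<open>n - 1 + (k - 1) s\<close>.\<close>

lemma bridge_lower_bound_aux:
  assumes e: "0 < e" "e \<le> 1 / 4"
  shows "\<exists>\<delta>>0. \<exists>n0. \<forall>n\<ge>n0. 0 < \<phi> ^ n $ (n - 1) \<longrightarrow>
    e / (real n + 1) * (\<delta> * (exp (- e * real n) * (\<phi> $ 0) powr (2 * e * real n + 1))) \<le> \<phi> ^ n $ (n - 1)"
proof -
  \<comment> \<open>Jumps of size at least \<open>1 / e\<close> fit at most \<open>e * n\<close>
    times into a gap of at most \<open>n\<close>.\<close>
  obtain k where k: "nat \<lceil>1 / e\<rceil> \<le> k" "exp (- e * real k) \<le> \<phi> $ k"
    using subexponential[OF e(1)] by blast
  have "1 / e \<le> real k" using k(1) by linarith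
  then have ke: "1 \<le> e * real k" using e by (simp add: field_simps)
  then have "0 < k" by (cases k) auto
  obtain L T \<delta> where \<delta>: "0 < \<delta>" and rep: "\<And>l t. 0 < \<phi> ^ l $ t \<Longrightarrow>
      \<exists>l' t'. l' \<le> L \<and> t' \<le> T \<and> \<delta> \<le> \<phi> ^ l' $ t' \<and> t' mod k = t mod k"
    using residue_representatives[OF \<open>0 < k\<close>] by metis
  have "e / (real n + 1) * (\<delta> * (exp (- e * real n) * (\<phi> $ 0) powr (2 * e * real n + 1))) \<le> \<phi> ^ n $ (n - 1)"
    if n: "nat \<lceil>(real L + real T + 1) / e\<rceil> \<le> n" and pos: "0 < \<phi> ^ n $ (n - 1)" for n
  proof -
    \<comment> \<open>For these \<open>n\<close>, up to \<open>L\<close> adjusting steps and at most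
      \<open>e * n\<close> jumps fit into the last \<open>r\<close> steps, and the gap
      \<open>R\<close> is at least \<open>T\<close>.\<close>
    have "(real L + real T + 1) / e \<le> real n" using n by linarith
    then have ne: "real L + real T + 1 \<le> e * real n" using e by (simp add: field_simps)
    then have "0 < n" using e by (cases n) auto
    define r where "r = nat \<lceil>2 * e * real n\<rceil>"
    define n' where "n' = n - r"
    define M where "M = nat \<lfloor>(1 - e) * real n\<rfloor>"
    have r: "2 * e * real n \<le> real r" "real r \<le> 2 * e * real n + 1"
    proof -
      have "0 \<le> 2 * e * real n" using e by simp
      then show "2 * e * real n \<le> real r" "real r \<le> 2 * e * real n + 1"
        unfolding r_def by linarith+
    qed
    have "2 * e * real n \<le> real n" using e by (simp add: mult_left_le_one_le)
    then have rn: "r \<le> n" unfolding r_def by linarith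
    have M: "real M \<le> (1 - e) * real n" "(1 - e) * real n \<le> real (Suc M)"
    proof -
      have "0 \<le> (1 - e) * real n" using e by simp
      then show "real M \<le> (1 - e) * real n" "(1 - e) * real n \<le> real (Suc M)"
        unfolding M_def by linarith+
    qed
    have "real n' \<le> real n - 2 * e * real n" using r rn by (simp add: n'_def of_nat_diff)
    also have "\<dots> \<le> (1 - e) * ((1 - e) * real n)" using e by (simp add: algebra_simps)
    also have "\<dots> \<le> (1 - e) * real (Suc M)" using M e by (intro mult_left_mono) auto
    finally have "real n' / real (Suc M) \<le> 1 - e" by (simp add: field_simps)
    then have mass: "e \<le> (\<Sum>k\<le>M. \<phi> ^ n' $ k)" using power_markov[of n' M] by linarith
    have "(1 - e) * real n \<le> real n - 1" using ne by (simp add: algebra_simps)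
    with M have Mn: "real M \<le> real n - 1" by linarith
    have "\<exists>s\<le>M. e / (real n + 1) \<le> \<phi> ^ n' $ s"
    proof (rule ccontr)
      assume "\<not> ?thesis"
      then have "(\<Sum>k\<le>M. \<phi> ^ n' $ k) < (\<Sum>k\<le>M. e / (real n + 1))"
        by (intro sum_strict_mono) auto
      also have "\<dots> = real (Suc M) * e / (real n + 1)" by simp
      also have "\<dots> \<le> e" using Mn e by (simp add: field_simps)
      finally show False using mass by simp
    qed
    then obtain s where s: "s \<le> M" "e / (real n + 1) \<le> \<phi> ^ n' $ s" by blast
    define R where "R = n - 1 - s"
    have sn: "s \<le> n - 1" using s Mn \<open>0 < n\<close> by linarith
    have "real R = real n - 1 - real s" using sn \<open>0 < n\<close> by (simp add: R_def of_nat_diff)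
    moreover have "real s \<le> (1 - e) * real n" using s M by linarith
    ultimately have "real T \<le> real R" using ne by (simp add: algebra_simps)
    then have TR: "T \<le> R" by simp
    have spos: "0 < \<phi> ^ n' $ s"
      using s e by (meson divide_pos_pos less_le_trans of_nat_0_le_iff add_nonneg_pos zero_less_one)
    \<comment> \<open>The bridge followed by \<open>k - 1\<close> words of sum \<open>s\<close>
      witnesses that the residue of the gap is attainable.\<close>
    have "0 < (\<phi> ^ n' $ s) ^ (k - 1)" using spos by simp
    also have "\<dots> \<le> \<phi> ^ (n' * (k - 1)) $ ((k - 1) * s)"
      unfolding power_mult by (intro fps_power_nth_ge fps_nonneg_power fps_nonneg)
    finally have "0 < \<phi> ^ n $ (n - 1) * \<phi> ^ (n' * (k - 1)) $ ((k - 1) * s)"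
      using pos by simp
    also have "\<dots> \<le> \<phi> ^ (n + n' * (k - 1)) $ (n - 1 + (k - 1) * s)" by (rule power_nth_add)
    finally obtain l' t' where lt: "l' \<le> L" "t' \<le> T" "\<delta> \<le> \<phi> ^ l' $ t'"
        "t' mod k = (n - 1 + (k - 1) * s) mod k"
      using rep by blast
    have "n - 1 + (k - 1) * s = R + k * s"
      using sn \<open>0 < k\<close> by (cases k) (auto simp: R_def)
    then have "R mod k = t' mod k" using lt(4) by simp
    moreover have "t' \<le> R" using lt TR by simp
    ultimately obtain j where j: "R = t' + k * j"
      using mod_eq_dvd_iff_nat[of t' R k] by (auto simp: dvd_def algebra_simps)
        (metis le_add_diff_inverse)
    have "k * j \<le> n" using j by (simp add: R_def)
    then have kj: "real (k * j) \<le> real n" by (rule of_nat_mono)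
    have "real j \<le> (e * real k) * real j" using mult_right_mono[OF ke, of "real j"] by simp
    also have "\<dots> \<le> e * real n" using kj e by (simp add: mult.assoc)
    finally have "real (l' + j) \<le> real r" using lt(1) ne r by simp
    then have lj: "l' + j \<le> r" by simp
    define z where "z = r - l' - j"
    have n_eq: "n = n' + (l' + (j + z))" using lj rn by (simp add: n'_def z_def)
    have "n - 1 = s + R" using sn by (simp add: R_def)
    then have n1_eq: "n - 1 = s + (t' + (j * k + z * 0))" by (simp add: j mult.commute)
    have \<phi>0: "\<phi> $ 0 \<le> 1" using sum_nth_le_1[of 0] by simp
    have "(\<phi> $ 0) powr (2 * e * real n + 1) \<le> (\<phi> $ 0) powr real z"
      using r nth_0_pos \<phi>0 by (intro powr_mono') (auto simp: z_def)
    then have z: "(\<phi> $ 0) powr (2 * e * real n + 1) \<le> (\<phi> $ 0) ^ z"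
      using nth_0_pos by (simp add: powr_realpow)
    have "exp (- e * real n) \<le> exp (- e * real k) ^ j"
      using kj e by (simp add: exp_of_nat_mult[symmetric] mult_ac)
    also have "\<dots> \<le> (\<phi> $ k) ^ j" using k(2) by (intro power_mono) auto
    finally have kj': "exp (- e * real n) \<le> (\<phi> $ k) ^ j" .
    have "e / (real n + 1) * (\<delta> * (exp (- e * real n) * (\<phi> $ 0) powr (2 * e * real n + 1)))
        \<le> \<phi> ^ n' $ s * (\<phi> ^ l' $ t' * (\<phi> ^ j $ (j * k) * \<phi> ^ z $ (z * 0)))"
      using s(2) lt(3) kj' z e \<delta>
      by (intro mult_mono order_trans[OF _ fps_power_nth_ge[OF fps_nonneg]] mult_nonneg_nonneg
          power_nonneg) auto
    also have "\<dots> \<le> \<phi> ^ n' $ s * (\<phi> ^ l' $ t' * \<phi> ^ (j + z) $ (j * k + z * 0))"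
      by (intro mult_left_mono power_nth_add power_nonneg)
    also have "\<dots> \<le> \<phi> ^ n' $ s * \<phi> ^ (l' + (j + z)) $ (t' + (j * k + z * 0))"
      by (intro mult_left_mono power_nth_add power_nonneg)
    also have "\<dots> \<le> \<phi> ^ n $ (n - 1)"
      using power_nth_add[of n' s "l' + (j + z)" "t' + (j * k + z * 0)"]
      by (simp only: n_eq[symmetric] n1_eq[symmetric])
    finally show ?thesis .
  qed
  then show ?thesis using \<delta> by blast
qed

lemma bridge_lower_bound:
  assumes \<eta>: "0 < \<eta>"
  shows "\<forall>\<^sub>F n in sequentially. 0 < \<phi> ^ n $ (n - 1) \<longrightarrow> exp (- \<eta> * real n) \<le> \<phi> ^ n $ (n - 1)"
proof -
  define c where "c = - ln (\<phi> $ 0)"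
  have "\<phi> $ 0 \<le> 1" using sum_nth_le_1[of 0] by simp
  then have c: "0 \<le> c" using nth_0_pos by (simp add: c_def)
  \<comment> \<open>The bound of \<open>bridge_lower_bound_aux\<close> decays at rate
    \<open>e + 2 * e * c\<close>; this \<open>e\<close> makes it at most \<open>\<eta> / 2\<close>,
    and the other half of \<open>\<eta>\<close> absorbs the remaining factors.\<close>
  define e where "e = min (1 / 4) (\<eta> / (2 + 4 * c))"
  have e: "0 < e" using \<eta> c by (simp add: e_def)
  have e': "e \<le> 1 / 4" unfolding e_def by (rule min.cobounded1)
  have "e \<le> \<eta> / (2 + 4 * c)" by (simp add: e_def)
  then have ec: "e + 2 * e * c \<le> \<eta> / 2" using c by (simp add: field_simps)
  obtain \<delta> n0 where \<delta>: "0 < \<delta>" and bound: "\<And>n. n0 \<le> n \<Longrightarrow> 0 < \<phi> ^ n $ (n - 1) \<Longrightarrow>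
      e / (real n + 1) * (\<delta> * (exp (- e * real n) * (\<phi> $ 0) powr (2 * e * real n + 1))) \<le> \<phi> ^ n $ (n - 1)"
    using bridge_lower_bound_aux[OF e e'] by metis
  define C where "C = ln (e * \<delta>) - c"
  have "\<forall>\<^sub>F n::nat in sequentially. - (\<eta> / 2) * real n \<le> C - ln (real n + 1)"
    using \<eta> by real_asymp
  then show ?thesis
    using eventually_ge_at_top[of n0]
  proof eventually_elim
    case (elim n)
    have "(e + 2 * e * c) * real n \<le> \<eta> / 2 * real n" using ec by (intro mult_right_mono) auto
    then have "- \<eta> * real n \<le> ln (e * \<delta>) - ln (real n + 1) - e * real n - c * (2 * e * real n + 1)"
      using elim(1) by (simp add: C_def algebra_simps)
    then have "exp (- \<eta> * real n)
        \<le> exp (ln (e * \<delta>) - ln (real n + 1) - e * real n - c * (2 * e * real n + 1))" by simp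
    also have "\<dots> = e / (real n + 1) * (\<delta> * (exp (- e * real n) * (\<phi> $ 0) powr (2 * e * real n + 1)))"
      using e \<delta> nth_0_pos by (simp add: exp_diff exp_add exp_minus powr_def c_def field_simps)
    finally show ?case using bound[OF elim(2)] by linarith
  qed
qed

text \<open>On a path with total \<open>n - 1\<close>, the product of the factors
  \<open>1 + p * (x - 1)\<close> is at most \<open>exp (- p - p\<^sup>2 / 4 * S)\<close>, with
  \<open>S\<close> the sum of its truncated squares. Either \<open>S \<ge> n * A / 2\<close>, or the
  path is charged to a Chernoff bound for \<open>S\<close>, whose rate \<open>\<delta>\<close> does
  not depend on \<open>p\<close>.\<close>

lemma marked_power_upper_bound:
  assumes A: "0 < A" "A = (\<Sum>k=2..K. \<phi> $ k * (real k - 1)\<^sup>2)"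
  shows "\<exists>\<delta>>0. \<forall>n\<ge>1. \<forall>p. 0 \<le> p \<longrightarrow> p \<le> 1 \<longrightarrow> p * real K \<le> 1 \<longrightarrow>
    (fps_const (1 - p) * \<phi> + fps_const p * (fps_X * fps_deriv \<phi>)) ^ n $ (n - 1)
      \<le> exp (- (p\<^sup>2 * real n * A / 8)) * \<phi> ^ n $ (n - 1) + exp (- \<delta> * real n)"
proof -
  define V where "V k = (if 2 \<le> k \<and> k \<le> K then (real k - 1)\<^sup>2 else 0)" for k
  have V: "0 \<le> V k" for k by (simp add: V_def)
  define B where "B = (\<Sum>k=2..K. \<phi> $ k * (V k)\<^sup>2)"
  \<comment> \<open>Minimizes the Chernoff exponent \<open>- l * A / 2 + l\<^sup>2 * B / 2\<close>,
    whose value is then \<open>- \<delta>\<close>.\<close>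
  define l where "l = A / (2 * B)"
  define \<delta> where "\<delta> = l * A / 4"
  have "B \<noteq> 0"
  proof
    assume "B = 0"
    then have "\<forall>k\<in>{2..K}. \<phi> $ k * (V k)\<^sup>2 = 0"
      unfolding B_def by (subst (asm) sum_nonneg_eq_0_iff) (auto simp: nonneg)
    then have "A = 0" unfolding A(2) by (intro sum.neutral) (auto simp: V_def)
    then show False using A by simp
  qed
  moreover have "0 \<le> B" unfolding B_def by (intro sum_nonneg) (simp add: nonneg)
  ultimately have B: "0 < B" by simp
  have l: "0 < l" using A B by (simp add: l_def)
  have \<delta>: "0 < \<delta>" using A l by (simp add: \<delta>_def)
  \<comment> \<open>The exponentially tilted, unnormalized step law; \<open>Z\<close> bounds its
    total mass.\<close>
  define \<rho> where "\<rho> = Abs_fps (\<lambda>k. \<phi> $ k * exp (- l * V k))"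
  define Z where "Z = 1 - l * A + l\<^sup>2 * B / 2"
  have "fps_nonneg \<rho>" by (simp add: fps_nonneg_def \<rho>_def nonneg)
  have Z: "(\<Sum>i\<le>m. \<rho> $ i) \<le> Z" for m
  proof -
    have "(\<Sum>i\<le>m. \<rho> $ i) \<le> (\<Sum>i\<le>m + K. \<rho> $ i)"
      using \<open>fps_nonneg \<rho>\<close> by (intro sum_mono2) (auto simp: fps_nonneg_def)
    also have "\<dots> \<le> (\<Sum>i\<le>m + K. \<phi> $ i * (1 - l * V i + (l * V i)\<^sup>2 / 2))"
      unfolding \<rho>_def fps_nth_Abs_fps
      using exp_minus_le_quadratic[of "l * V _"] V l nonneg
      by (intro sum_mono mult_left_mono) auto
    also have "\<dots> = (\<Sum>i\<le>m + K. \<phi> $ i) - l * (\<Sum>i\<le>m + K. \<phi> $ i * V i)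
        + l\<^sup>2 / 2 * (\<Sum>i\<le>m + K. \<phi> $ i * (V i)\<^sup>2)"
      by (simp add: sum_distrib_left sum.distrib sum_subtractf algebra_simps)
    also have "(\<Sum>i\<le>m + K. \<phi> $ i * V i) = A"
      unfolding A(2) by (rule sum.mono_neutral_cong_right) (auto simp: V_def)
    also have "(\<Sum>i\<le>m + K. \<phi> $ i * (V i)\<^sup>2) = B"
      unfolding B_def by (rule sum.mono_neutral_cong_right) (auto simp: V_def)
    finally show ?thesis using sum_nth_le_1[of "m + K"] by (simp add: Z_def)
  qed
  have "0 \<le> Z" using Z[of 0] \<open>fps_nonneg \<rho>\<close> by (auto simp: fps_nonneg_def intro: order_trans)
  have lB: "l\<^sup>2 * B = l * A / 2" using B by (simp add: l_def power2_eq_square field_simps)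
  have "(fps_const (1 - p) * \<phi> + fps_const p * (fps_X * fps_deriv \<phi>)) ^ n $ (n - 1)
      \<le> exp (- (p\<^sup>2 * real n * A / 8)) * \<phi> ^ n $ (n - 1) + exp (- \<delta> * real n)"
    if n: "1 \<le> n" and p: "0 \<le> p" "p \<le> 1" "p * real K \<le> 1" for n p
  proof -
    define \<psi> where "\<psi> = fps_const (1 - p) * \<phi> + fps_const p * (fps_X * fps_deriv \<phi>)"
    have \<psi>: "\<psi> $ k = \<phi> $ k * (1 + p * (real k - 1))" for k
      unfolding \<psi>_def fps_add_nth fps_mult_left_const_nth fps_X_deriv_nth
      by (simp add: algebra_simps)
    have \<psi>0: "0 \<le> \<psi> $ k" for k
    proof -
      have "1 + p * (real k - 1) = (1 - p) + p * real k" by (simp add: algebra_simps)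
      moreover have "0 \<le> (1 - p) + p * real k" using p by simp
      ultimately show ?thesis unfolding \<psi> using nonneg[of k] by simp
    qed
    have \<psi>e: "\<psi> $ k \<le> \<phi> $ k * exp (p * (real k - 1) - p\<^sup>2 / 4 * V k)" for k
    proof -
      have "1 + p * (real k - 1) \<le> exp (p * (real k - 1) - p\<^sup>2 / 4 * V k)"
      proof (cases "2 \<le> k \<and> k \<le> K")
        case True
        have "p * (real k - 1) \<le> p * real K" using True p by (intro mult_left_mono) auto
        then show ?thesis
          using one_plus_le_exp_minus_square[of "p * (real k - 1)"] True p
          by (simp add: V_def power_mult_distrib)
      next
        case False
        then have "V k = 0" unfolding V_def by (rule if_not_P)
        then show ?thesis using exp_ge_add_one_self[of "p * (real k - 1)"] by simp
      qed
      then show ?thesis unfolding \<psi> by (intro mult_left_mono nonneg)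
    qed
    have \<rho>_prod: "(\<Prod>x\<leftarrow>xs. \<rho> $ x) = (\<Prod>x\<leftarrow>xs. \<phi> $ x) * exp (- l * (\<Sum>x\<leftarrow>xs. V x))" for xs
      by (induction xs) (simp_all add: \<rho>_def exp_add distrib_left exp_diff exp_minus field_simps)
    have word: "(\<Prod>x\<leftarrow>xs. \<psi> $ x) \<le> exp (- (p\<^sup>2 * real n * A / 8)) * (\<Prod>x\<leftarrow>xs. \<phi> $ x)
        + exp (l * real n * A / 2) * (\<Prod>x\<leftarrow>xs. \<rho> $ x)" if xs: "xs \<in> words n (n - 1)" for xs
    proof -
      define S where "S = (\<Sum>x\<leftarrow>xs. V x)"
      have P0: "0 \<le> (\<Prod>x\<leftarrow>xs. \<phi> $ x)" by (intro prod_list_nonneg) (auto simp: nonneg)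
      have "(\<Sum>x\<leftarrow>xs. p * (real x - 1) - p\<^sup>2 / 4 * V x)
          = p * (real (sum_list xs) - real (length xs)) - p\<^sup>2 / 4 * S"
        unfolding S_def by (induction xs) (simp_all add: algebra_simps add_divide_distrib)
      also have "\<dots> = - p - p\<^sup>2 / 4 * S"
        using xs n by (simp add: words_def of_nat_diff algebra_simps)
      finally have "(\<Prod>x\<leftarrow>xs. \<psi> $ x) \<le> (\<Prod>x\<leftarrow>xs. \<phi> $ x) * exp (- p - p\<^sup>2 / 4 * S)"
        using prod_list_le_exp[of "\<lambda>k. \<psi> $ k", OF \<psi>0 \<psi>e] by metis
      also have "exp (- p - p\<^sup>2 / 4 * S) \<le> exp (- (p\<^sup>2 * real n * A / 8)) + exp (l * (real n * A / 2 - S))"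
      proof (cases "real n * A / 2 \<le> S")
        case True
        then have "p\<^sup>2 / 4 * (real n * A / 2) \<le> p\<^sup>2 / 4 * S" by (intro mult_left_mono) auto
        moreover have "p\<^sup>2 / 4 * (real n * A / 2) = p\<^sup>2 * real n * A / 8" by simp
        ultimately have "- p - p\<^sup>2 / 4 * S \<le> - (p\<^sup>2 * real n * A / 8)" using p by linarith
        then have "exp (- p - p\<^sup>2 / 4 * S) \<le> exp (- (p\<^sup>2 * real n * A / 8))" by simp
        then show ?thesis by (simp add: add_increasing2)
      next
        case False
        have "0 \<le> S" unfolding S_def by (intro sum_list_nonneg) (auto simp: V)
        then have "0 \<le> p\<^sup>2 / 4 * S" by simp
        then have "- p - p\<^sup>2 / 4 * S \<le> l * (real n * A / 2 - S)"
          using False p l by (auto intro: order_trans[of _ 0])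
        then have "exp (- p - p\<^sup>2 / 4 * S) \<le> exp (l * (real n * A / 2 - S))" by simp
        then show ?thesis by (simp add: add_increasing)
      qed
      finally have "(\<Prod>x\<leftarrow>xs. \<psi> $ x) \<le> (\<Prod>x\<leftarrow>xs. \<phi> $ x)
          * (exp (- (p\<^sup>2 * real n * A / 8)) + exp (l * (real n * A / 2 - S)))"
        using P0 by (simp add: mult_left_mono)
      also have "\<dots> = exp (- (p\<^sup>2 * real n * A / 8)) * (\<Prod>x\<leftarrow>xs. \<phi> $ x)
          + exp (l * real n * A / 2) * (\<Prod>x\<leftarrow>xs. \<rho> $ x)"
        unfolding \<rho>_prod S_def[symmetric]
        by (simp add: algebra_simps exp_add[symmetric] exp_diff exp_minus) (simp add: field_simps exp_add[symmetric])
      finally show ?thesis .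
    qed
    have "\<psi> ^ n $ (n - 1) \<le> exp (- (p\<^sup>2 * real n * A / 8)) * \<phi> ^ n $ (n - 1)
        + exp (l * real n * A / 2) * \<rho> ^ n $ (n - 1)"
      unfolding fps_power_nth_words sum_distrib_left sum.distrib[symmetric]
      by (intro sum_mono word)
    also have "\<rho> ^ n $ (n - 1) \<le> Z ^ n"
      using fps_power_nth_le[OF \<open>fps_nonneg \<rho>\<close> Z] .
    also have "Z ^ n \<le> exp (- l * A + l\<^sup>2 * B / 2) ^ n"
    proof (rule power_mono[OF _ \<open>0 \<le> Z\<close>])
      show "Z \<le> exp (- l * A + l\<^sup>2 * B / 2)"
        using exp_ge_add_one_self[of "- l * A + l\<^sup>2 * B / 2"] unfolding Z_def by linarith
    qed
    also have "exp (l * real n * A / 2) * exp (- l * A + l\<^sup>2 * B / 2) ^ n = exp (- \<delta> * real n)"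
      unfolding exp_of_nat_mult[symmetric] exp_add[symmetric] lB
      by (simp add: \<delta>_def algebra_simps)
    finally show ?thesis by (simp add: \<psi>_def)
  qed
  then show ?thesis using \<delta> by blast
qed

section \<open>Depth of a uniformly random vertex\<close>

sublocale tree_fps \<phi> "tree_gf \<phi> (\<lambda>_. 1)"
  by (rule tree_fps_tree_gf)

abbreviation marked where "marked h \<equiv> marked_bridge h 0"

text \<open>Links walk and tree: \<open>marked h n\<close>, divided by \<open>n\<close> times the
  probability of size \<open>n\<close>, is the probability that a uniform vertex of the conditioned
  tree has depth at least \<open>h\<close>.\<close>

lemma marked_eq_level_sum: "Abs_fps (marked h) = tree_gf \<phi> (level_sum (\<lambda>t. real (nodes t)) h)"
  by (simp add: lagrange_inversion_marked_bridge tree_gf_level_sum tree_gf_nodes)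

lemma weight_nonneg: "0 \<le> weight \<phi> t"
proof (induction t)
  case (Node ts)
  then show ?case by (auto intro!: mult_nonneg_nonneg prod_list_nonneg nonneg)
qed

lemma marked_eq_sum:
  "marked h n = (\<Sum>t | nodes t = n. weight \<phi> t * level_sum (\<lambda>t. real (nodes t)) h t)"
  using arg_cong[OF marked_eq_level_sum, of "\<lambda>f. f $ n" h] by (simp add: tree_gf_def)

lemma marked_nonneg: "0 \<le> marked h n"
  unfolding marked_eq_sum
  by (intro sum_nonneg mult_nonneg_nonneg weight_nonneg level_sum_nonneg) simp

text \<open>Seen on the tree side, where fewer vertices remain at greater depth. This is what makes
  the randomization of \<open>h\<close> work.\<close>

lemma marked_antimono: "i \<le> j \<Longrightarrow> marked j n \<le> marked i n"
proof (induction rule: dec_induct)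
  case (step j)
  have "marked (Suc j) n \<le> marked j n"
    unfolding marked_eq_sum
    by (intro sum_mono mult_left_mono weight_nonneg level_sum_nodes_decreasing)
  with step show ?case by simp
qed simp

text \<open>The marked bridges with a binomial number of marks have an explicit product form, and a
  binomial variable is at most twice its mean with probability at least one half.\<close>

lemma marked_le_power:
  assumes p: "0 \<le> p" "p \<le> 1" and h: "2 * real n * p = real h" "0 < h"
  shows "marked h n \<le> 2 * (fps_const (1 - p) * \<phi> + fps_const p * (fps_X * fps_deriv \<phi>)) ^ n $ (n - 1)"
proof -
  let ?Y = "fps_X * fps_deriv \<phi>"
  have "(fps_const p * ?Y + fps_const (1 - p) * \<phi>) ^ n
      = (\<Sum>j\<le>n. of_nat (n choose j) * (fps_const p * ?Y) ^ j * (fps_const (1 - p) * \<phi>) ^ (n - j))"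
    by (rule binomial_ring)
  also have "\<dots> = (\<Sum>j\<le>n. fps_const (Bernstein n j p) * (?Y ^ j * \<phi> ^ (n - j)))"
    by (intro sum.cong)
      (simp_all add: Bernstein_def power_mult_distrib fps_const_power fps_of_nat[symmetric]
        fps_const_mult[symmetric] mult_ac del: fps_const_mult)
  finally have "(fps_const p * ?Y + fps_const (1 - p) * \<phi>) ^ n $ (n - 1)
      = (\<Sum>j\<le>n. Bernstein n j p * (?Y ^ j * \<phi> ^ (n - j)) $ (n - 1))"
    by (simp add: fps_sum_nth)
  \<comment> \<open>The factor \<open>1 - j / h\<close> is a linear lower bound for the indicator of
    \<open>j \<le> h\<close>, so that only the mean \<open>n * p = h / 2\<close> of the binomial law
    enters.\<close>
  moreover have "marked h n * (1 - real j / real h) \<le> (?Y ^ j * \<phi> ^ (n - j)) $ (n - 1)" for j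
  proof -
    have "0 \<le> (?Y ^ j * \<phi> ^ (n - j)) $ (n - 1)"
      by (intro fps_nonnegD fps_nonneg_mult fps_nonneg_power fps_nonneg_X_deriv fps_nonneg)
    then have "marked j n \<le> (?Y ^ j * \<phi> ^ (n - j)) $ (n - 1)"
      by (auto simp: marked_bridge_def)
    moreover have "marked h n * (1 - real j / real h) \<le> marked j n"
    proof (cases "j \<le> h")
      case True
      have "marked h n * (1 - real j / real h) \<le> marked h n * 1"
        using marked_nonneg h by (intro mult_left_mono) auto
      then show ?thesis using marked_antimono[OF True, of n] by simp
    next
      case False
      then have "1 - real j / real h \<le> 0" using h by simp
      then show ?thesis
        using marked_nonneg by (meson mult_nonneg_nonpos order_trans)
    qed
    ultimately show ?thesis by simp
  qed
  then have "(\<Sum>j\<le>n. Bernstein n j p * (marked h n * (1 - real j / real h)))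
      \<le> (\<Sum>j\<le>n. Bernstein n j p * (?Y ^ j * \<phi> ^ (n - j)) $ (n - 1))"
    using p by (intro sum_mono mult_left_mono Bernstein_nonneg)
  moreover have "(\<Sum>j\<le>n. Bernstein n j p * (marked h n * (1 - real j / real h)))
      = marked h n * ((\<Sum>j\<le>n. Bernstein n j p) - (\<Sum>j\<le>n. real j * Bernstein n j p) / real h)"
    by (simp add: sum_distrib_left sum_divide_distrib sum_subtractf[symmetric] algebra_simps
        del: sum_Bernstein sum_k_Bernstein)
  moreover have "real n * p / real h = 1 / 2" using h by (simp add: field_simps)
  ultimately show ?thesis by (simp add: add.commute)
qed

lemma marked_le_quarter:
  assumes \<epsilon>: "0 < \<epsilon>"
  shows "\<forall>\<^sub>F n in sequentially. 0 < \<phi> ^ n $ (n - 1) \<longrightarrow>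
    marked (nat \<lceil>\<epsilon> * sqrt (real n)\<rceil>) n \<le> \<phi> ^ n $ (n - 1) / 4"
proof -
  \<comment> \<open>Chosen so that \<open>p\<^sup>2 * n * A / 8 \<ge> ln 16\<close>. Each of the two
    error terms is to be at most \<open>1 / 16\<close> of the bridge probability, as
    \<open>marked_le_power\<close> costs a factor \<open>2\<close>.\<close>
  define C where "C = 32 * ln 16 / \<epsilon>\<^sup>2"
  have "0 < C" using \<epsilon> by (simp add: C_def)
  obtain K where K: "C \<le> (\<Sum>k=2..K. \<phi> $ k * (real k - 1)\<^sup>2)"
    using truncated_variance_unbounded by blast
  define A where "A = (\<Sum>k=2..K. \<phi> $ k * (real k - 1)\<^sup>2)"
  have A: "0 < A" "C \<le> A" using K \<open>0 < C\<close> by (auto simp: A_def)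
  obtain \<delta> where \<delta>: "0 < \<delta>" and upper: "\<And>n p. 1 \<le> n \<Longrightarrow> 0 \<le> p \<Longrightarrow> p \<le> 1 \<Longrightarrow> p * real K \<le> 1 \<Longrightarrow>
    (fps_const (1 - p) * \<phi> + fps_const p * (fps_X * fps_deriv \<phi>)) ^ n $ (n - 1)
      \<le> exp (- (p\<^sup>2 * real n * A / 8)) * \<phi> ^ n $ (n - 1) + exp (- \<delta> * real n)"
    using marked_power_upper_bound[OF A(1) A_def] by blast
  have "\<forall>\<^sub>F n in sequentially. 0 < \<phi> ^ n $ (n - 1) \<longrightarrow> exp (- (\<delta> / 2) * real n) \<le> \<phi> ^ n $ (n - 1)"
    using \<delta> by (intro bridge_lower_bound) simp
  moreover have "\<forall>\<^sub>F n in sequentially. exp (- (\<delta> / 2) * real n) \<le> 1 / 16"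
    using \<delta> by real_asymp
  moreover have "\<forall>\<^sub>F n in sequentially. (\<epsilon> * sqrt (real n) + 1) / (2 * real n) * (real K + 1) \<le> 1"
    by real_asymp
  ultimately show ?thesis using eventually_ge_at_top[of 1]
  proof eventually_elim
    case (elim n)
    show ?case
    proof
      assume pos: "0 < \<phi> ^ n $ (n - 1)"
      define h where "h = nat \<lceil>\<epsilon> * sqrt (real n)\<rceil>"
      define p where "p = real h / (2 * real n)"
      have "0 < \<epsilon> * sqrt (real n)" using \<epsilon> elim by simp
      then have h: "\<epsilon> * sqrt (real n) \<le> real h" "real h \<le> \<epsilon> * sqrt (real n) + 1" "0 < h"
        unfolding h_def by linarith+
      have "p \<le> (\<epsilon> * sqrt (real n) + 1) / (2 * real n)"
        unfolding p_def using h by (intro divide_right_mono) auto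
      then have "p * (real K + 1) \<le> (\<epsilon> * sqrt (real n) + 1) / (2 * real n) * (real K + 1)"
        by (intro mult_right_mono) auto
      then have pK: "p * (real K + 1) \<le> 1" using elim by linarith
      have p0: "0 \<le> p" by (simp add: p_def)
      have "p * (real K + 1) = p * real K + p" "0 \<le> p * real K"
        using p0 by (simp_all add: distrib_left)
      then have p: "p * real K \<le> 1" "p \<le> 1"
        using pK p0 by linarith+
      have "\<epsilon>\<^sup>2 * real n \<le> (real h)\<^sup>2"
        using power_mono[OF h(1), of 2] \<epsilon> by (simp add: power_mult_distrib)
      then have "\<epsilon>\<^sup>2 / 4 \<le> p\<^sup>2 * real n"
        using elim by (simp add: p_def power_divide power_mult_distrib power2_eq_square field_simps)
      then have "\<epsilon>\<^sup>2 / 4 * C \<le> p\<^sup>2 * real n * A" using A \<open>0 < C\<close> by (intro mult_mono) auto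
      then have "ln 16 \<le> p\<^sup>2 * real n * A / 8" using \<epsilon> by (simp add: C_def)
      then have "exp (- (p\<^sup>2 * real n * A / 8)) \<le> exp (- ln 16)" by simp
      also have "\<dots> = 1 / 16" by (simp add: exp_minus)
      finally have 1: "exp (- (p\<^sup>2 * real n * A / 8)) * \<phi> ^ n $ (n - 1) \<le> 1 / 16 * \<phi> ^ n $ (n - 1)"
        using pos by (intro mult_right_mono) auto
      \<comment> \<open>Half of the rate pays for the bridge probability, the other half supplies
        the factor \<open>1 / 16\<close>.\<close>
      have "exp (- \<delta> * real n) = exp (- (\<delta> / 2) * real n) * exp (- (\<delta> / 2) * real n)"
        by (simp add: exp_add[symmetric])
      also have "\<dots> \<le> 1 / 16 * \<phi> ^ n $ (n - 1)"
        using elim pos by (intro mult_mono) auto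
      finally have "(fps_const (1 - p) * \<phi> + fps_const p * (fps_X * fps_deriv \<phi>)) ^ n $ (n - 1)
          \<le> \<phi> ^ n $ (n - 1) / 8"
        using upper[OF elim(4) p0 p(2,1)] 1 by linarith
      moreover have "2 * real n * p = real h" using elim by (simp add: p_def)
      ultimately show "marked (nat \<lceil>\<epsilon> * sqrt (real n)\<rceil>) n \<le> \<phi> ^ n $ (n - 1) / 4"
        using marked_le_power[OF p0 p(2) _ h(3)] by (fastforce simp: h_def)
    qed
  qed
qed

end

subsection \<open>The height of the conditioned tree\<close>

context infinite_variance_offspring
begin

abbreviation "tree_prob \<equiv> tree_gf \<phi> (\<lambda>_. 1)"

lemma tree_gf_nonneg: "(\<And>t. 0 \<le> a t) \<Longrightarrow> fps_nonneg (tree_gf \<phi> a)"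
  by (auto simp: fps_nonneg_def tree_gf_def intro!: sum_nonneg mult_nonneg_nonneg weight_nonneg)

lemma tree_gf_mono: "(\<And>t. nodes t = n \<Longrightarrow> a t \<le> b t) \<Longrightarrow> tree_gf \<phi> a $ n \<le> tree_gf \<phi> b $ n"
  by (auto simp: tree_gf_def intro!: sum_mono mult_left_mono weight_nonneg)

lemma tree_prob_eq: "real n * tree_prob $ n = (if n = 0 then 0 else \<phi> ^ n $ (n - 1))"
  using kemperman_formula[of n 1] by simp

lemma offspring_step_nonneg: "fps_nonneg (fps_X * (fps_deriv \<phi> oo tree_prob))"
proof (rule fps_nonneg_mult)
  show "fps_nonneg (fps_deriv \<phi> oo tree_prob)"
    unfolding fps_nonneg_def fps_compose_nth
    by (auto intro!: sum_nonneg mult_nonneg_nonneg fps_nonnegD[OF fps_nonneg_power] tree_gf_nonneg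
        simp: nonneg)
qed (auto simp: fps_nonneg_def fps_X_def)

text \<open>The subtrees above level \<open>h\<close> are conditioned trees themselves, and their sizes add up to the
  number of vertices above this level, which is at most a quarter of the tree on average. So a
  quadratic bound on the second moment of the height reproduces itself. Small trees are absorbed
  in the (truncated) subtraction of \<open>n0\<close>.\<close>

lemma height_second_moment:
  assumes \<epsilon>: "0 < \<epsilon>"
  obtains n0 where "\<And>n. tree_gf \<phi> (\<lambda>t. (real (height t - n0))\<^sup>2) $ n
    \<le> 16 * \<epsilon>\<^sup>2 * (real n * tree_prob $ n)"
proof -
  have "\<forall>\<^sub>F n in sequentially. 1 \<le> \<epsilon> * sqrt (real n)"
    using \<epsilon> by real_asymp
  with marked_le_quarter[OF \<epsilon>] have "\<forall>\<^sub>F n in sequentially. 1 \<le> \<epsilon> * sqrt (real n) \<and>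
    (0 < \<phi> ^ n $ (n - 1) \<longrightarrow> marked (nat \<lceil>\<epsilon> * sqrt (real n)\<rceil>) n \<le> \<phi> ^ n $ (n - 1) / 4)"
    by eventually_elim blast
  then obtain n0 where n0: "\<And>n. n0 \<le> n \<Longrightarrow> 1 \<le> \<epsilon> * sqrt (real n)"
    "\<And>n. n0 \<le> n \<Longrightarrow> 0 < \<phi> ^ n $ (n - 1) \<Longrightarrow>
      marked (nat \<lceil>\<epsilon> * sqrt (real n)\<rceil>) n \<le> \<phi> ^ n $ (n - 1) / 4"
    by (auto simp: eventually_sequentially)
  define g where "g m = (real (m - n0))\<^sup>2" for m
  \<comment> \<open>With this constant, \<open>2 * h\<^sup>2\<close> for the cut and
    \<open>2 * (C * n / 4)\<close> for the subtrees above it are each at most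
    \<open>C * n / 2\<close>.\<close>
  define C where "C = 16 * \<epsilon>\<^sup>2"
  have g: "mono g" "\<And>m. 0 \<le> g m" by (auto simp: g_def mono_def intro!: power_mono)
  have bound: "tree_gf \<phi> (\<lambda>t. g (height t)) $ n \<le> C * (real n * tree_prob $ n)" for n
  proof (induction n rule: less_induct)
    case (less n)
    have Q0: "0 \<le> tree_prob $ m" for m by (intro fps_nonnegD tree_gf_nonneg) simp
    show ?case
    proof (cases "n < n0")
      case True
      then have "g (height t) = 0" if "nodes t = n" for t
        using height_lt_nodes[of t] that by (simp add: g_def)
      then have "tree_gf \<phi> (\<lambda>t. g (height t)) $ n = 0" by (simp add: tree_gf_def)
      then show ?thesis using Q0 by (simp add: C_def)
    next
      case False
      then have "1 \<le> \<epsilon> * sqrt (real n)" using n0 by simp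
      then have n: "0 < n" by (cases n) auto
      show ?thesis
      proof (cases "\<phi> ^ n $ (n - 1) = 0")
        case True
        then have "tree_prob $ n = 0" using tree_prob_eq[of n] n by simp
        then have "\<forall>t. nodes t = n \<longrightarrow> weight \<phi> t = 0"
          unfolding tree_gf_def fps_nth_Abs_fps
          by (subst (asm) sum_nonneg_eq_0_iff) (auto simp: finite_nodes weight_nonneg)
        then have "tree_gf \<phi> (\<lambda>t. g (height t)) $ n = 0" by (simp add: tree_gf_def)
        then show ?thesis using Q0 by (simp add: C_def)
      next
        case pos: False
        define h where "h = nat \<lceil>\<epsilon> * sqrt (real n)\<rceil>"
        let ?Y = "fps_X * (fps_deriv \<phi> oo tree_prob)"
        have h: "real h \<le> 2 * (\<epsilon> * sqrt (real n))" "0 < h"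
          using \<open>1 \<le> \<epsilon> * sqrt (real n)\<close> unfolding h_def by linarith+
        have "(real h)\<^sup>2 \<le> (2 * (\<epsilon> * sqrt (real n)))\<^sup>2" using h by (intro power_mono) auto
        then have h2: "(real h)\<^sup>2 \<le> 4 * \<epsilon>\<^sup>2 * real n" by (simp add: power_mult_distrib)
        have quarter: "marked h n \<le> real n * tree_prob $ n / 4"
          using n0(2)[of n] False pos power_nonneg[of n "n - 1"] n by (simp add: h_def tree_prob_eq)
        have split: "g (height t) \<le> 2 * (real h)\<^sup>2 + 2 * level_sum (\<lambda>t. g (height t)) h t" for t
        proof -
          have L0: "0 \<le> level_sum (\<lambda>t. g (height t)) h t" by (intro level_sum_nonneg g)
          from height_le_level_sum[OF g, of t h] show ?thesis
          proof
            assume "height t \<le> h"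
            then have "g (height t) \<le> (real h)\<^sup>2" unfolding g_def by (intro power_mono) auto
            moreover have "0 \<le> (real h)\<^sup>2" by simp
            ultimately show ?thesis using L0 by linarith
          next
            assume "\<exists>m. height t \<le> h + m \<and> g m \<le> level_sum (\<lambda>t. g (height t)) h t"
            then obtain m where m: "height t \<le> h + m" "g m \<le> level_sum (\<lambda>t. g (height t)) h t" by blast
            have "g (height t) \<le> (real h + real (m - n0))\<^sup>2"
              unfolding g_def using m(1) by (intro power_mono) auto
            also have "\<dots> \<le> 2 * (real h)\<^sup>2 + 2 * g m"
              using sum_squares_bound[of "real h" "real (m - n0)"] by (simp add: g_def power2_sum)
            finally show ?thesis using m(2) by linarith
          qed
        qed
        have "tree_gf \<phi> (\<lambda>t. g (height t)) $ n
            \<le> tree_gf \<phi> (\<lambda>t. 2 * (real h)\<^sup>2 + 2 * level_sum (\<lambda>t. g (height t)) h t) $ n"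
          by (intro tree_gf_mono split)
        also have "\<dots> = 2 * (real h)\<^sup>2 * tree_prob $ n
            + 2 * tree_gf \<phi> (level_sum (\<lambda>t. g (height t)) h) $ n"
          by (simp add: tree_gf_def sum_distrib_left sum.distrib algebra_simps)
        also have "tree_gf \<phi> (level_sum (\<lambda>t. g (height t)) h) $ n
            = (\<Sum>i=0..n. ?Y ^ h $ i * tree_gf \<phi> (\<lambda>t. g (height t)) $ (n - i))"
          by (simp add: tree_gf_level_sum fps_mult_nth)
        also have "\<dots> \<le> (\<Sum>i=0..n. ?Y ^ h $ i * (C * (fps_X * fps_deriv tree_prob) $ (n - i)))"
        proof (rule sum_mono)
          fix i assume "i \<in> {0..n}"
          show "?Y ^ h $ i * tree_gf \<phi> (\<lambda>t. g (height t)) $ (n - i)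
              \<le> ?Y ^ h $ i * (C * (fps_X * fps_deriv tree_prob) $ (n - i))"
          \<comment> \<open>The coefficient at \<open>i = 0\<close> vanishes because
            \<open>h > 0\<close>, so the induction hypothesis is needed only for sizes below
            \<open>n\<close>.\<close>
          proof (cases i)
            case 0
            then show ?thesis using h by (simp add: fps_power_zeroth power_0_left)
          next
            case (Suc i')
            then show ?thesis
              unfolding fps_X_deriv_nth using n
              by (intro mult_left_mono less.IH fps_nonnegD fps_nonneg_power offspring_step_nonneg) auto
          qed
        qed
        also have "\<dots> = C * marked h n"
        proof -
          have "marked h n = (?Y ^ h * (fps_X * fps_deriv tree_prob)) $ n"
            using arg_cong[OF lagrange_inversion_marked_bridge, of "\<lambda>f. f $ n" h] by simp
          then have "marked h n = (\<Sum>i=0..n. ?Y ^ h $ i * (fps_X * fps_deriv tree_prob) $ (n - i))"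
            by (simp only: fps_mult_nth[of "?Y ^ h"])
          then show ?thesis by (simp only: sum_distrib_left mult.left_commute)
        qed
        also have "\<dots> \<le> C * (real n * tree_prob $ n / 4)"
          using quarter by (intro mult_left_mono) (auto simp: C_def)
        also have "2 * (real h)\<^sup>2 * tree_prob $ n \<le> 2 * (4 * \<epsilon>\<^sup>2 * real n) * tree_prob $ n"
          by (intro mult_right_mono mult_left_mono h2 Q0) simp
        finally show ?thesis by (simp add: C_def algebra_simps)
      qed
    qed
  qed
  then show ?thesis using that unfolding g_def C_def by blast
qed

text \<open>The inequality \<open>2 * a * x \<le> a\<^sup>2 + x\<^sup>2\<close> replaces
  Cauchy-Schwarz; \<open>a\<close> is the square root of the bound on the conditional second
  moment.\<close>

lemma height_first_moment:
  assumes \<epsilon>: "0 < \<epsilon>"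
  obtains n0 where "\<And>n. tree_gf \<phi> (\<lambda>t. real (height t)) $ n
    \<le> (real n0 + 4 * \<epsilon> * sqrt (real n)) * tree_prob $ n"
proof -
  obtain n0 where n0: "\<And>n. tree_gf \<phi> (\<lambda>t. (real (height t - n0))\<^sup>2) $ n
    \<le> 16 * \<epsilon>\<^sup>2 * (real n * tree_prob $ n)"
    using height_second_moment[OF \<epsilon>] by blast
  have "tree_gf \<phi> (\<lambda>t. real (height t)) $ n \<le> (real n0 + 4 * \<epsilon> * sqrt (real n)) * tree_prob $ n" for n
  proof (cases "n = 0")
    case False
    define a where "a = 4 * \<epsilon> * sqrt (real n)"
    have a: "0 < a" using \<epsilon> False by (simp add: a_def)
    have "real (height t) \<le> (real n0 + a / 2) + (real (height t - n0))\<^sup>2 / (2 * a)" for t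
    proof -
      define x where "x = real (height t - n0)"
      have "2 * a * x \<le> a\<^sup>2 + x\<^sup>2" by (rule sum_squares_bound)
      then have "x \<le> a / 2 + x\<^sup>2 / (2 * a)" using a by (simp add: field_simps power2_eq_square)
      moreover have "real (height t) \<le> real n0 + x" by (simp add: x_def)
      ultimately show ?thesis by (simp add: x_def)
    qed
    then have "tree_gf \<phi> (\<lambda>t. real (height t)) $ n
        \<le> tree_gf \<phi> (\<lambda>t. (real n0 + a / 2) + (real (height t - n0))\<^sup>2 / (2 * a)) $ n"
      by (intro tree_gf_mono)
    also have "\<dots> = (real n0 + a / 2) * tree_prob $ n
        + tree_gf \<phi> (\<lambda>t. (real (height t - n0))\<^sup>2) $ n / (2 * a)"
      by (simp add: tree_gf_def sum_distrib_left sum_divide_distrib sum.distrib algebra_simps)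
    also have "\<dots> \<le> (real n0 + a / 2) * tree_prob $ n + 16 * \<epsilon>\<^sup>2 * (real n * tree_prob $ n) / (2 * a)"
      using n0[of n] a by (intro add_left_mono divide_right_mono) auto
    also have "16 * \<epsilon>\<^sup>2 * (real n * tree_prob $ n) = a\<^sup>2 * tree_prob $ n"
      by (simp add: a_def power_mult_distrib)
    also have "a\<^sup>2 * tree_prob $ n / (2 * a) = a / 2 * tree_prob $ n"
      using a by (simp add: power2_eq_square)
    finally show ?thesis by (simp add: a_def algebra_simps)
  qed simp
  then show ?thesis using that by blast
qed

end

section \<open>From the moment norms to partial sums of the offspring law\<close>

lemma pmf_sums_1: "pmf \<mu> sums (1 :: real)" for \<mu> :: "nat pmf"
proof -
  have "(\<Sum>k. ennreal (pmf \<mu> k)) = emeasure \<mu> UNIV"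
    unfolding nn_integral_pmf[symmetric] by (rule nn_integral_count_space_nat[symmetric])
  then have eq: "(\<Sum>k. ennreal (pmf \<mu> k)) = 1"
    using measure_pmf.emeasure_space_1[of \<mu>] by (simp only: space_measure_pmf)
  then have s: "summable (pmf \<mu>)"
    by (intro summable_suminf_not_top) (simp_all only: pmf_nonneg ennreal_one_neq_top not_False_eq_True)
  have "ennreal (\<Sum>k. pmf \<mu> k) = ennreal 1"
    using suminf_ennreal2[OF pmf_nonneg s] eq by (simp only: ennreal_1)
  then have "(\<Sum>k. pmf \<mu> k) = 1"
    by (subst (asm) ennreal_inj) (auto intro: suminf_nonneg s)
  with s show ?thesis unfolding sums_iff by blast
qed

lemma moment_norm_partial_sum_le:
  assumes "moment_norm 1 \<mu> \<le> 1"
  shows "(\<Sum>k\<le>m. real k * pmf \<mu> k) \<le> 1"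
proof -
  define S where "S = (\<Sum>k. ennreal (real k powr 1 * pmf \<mu> k))"
  have norm: "(if S = \<infinity> then \<infinity> else ennreal (enn2real S powr (1 / 1))) \<le> 1"
    using assms by (simp only: moment_norm_def S_def Let_def)
  then have S: "S \<noteq> \<infinity>" by (auto simp: top_unique split: if_splits)
  then have "enn2real S \<le> 1" using norm by (simp add: ennreal_le_1)
  moreover have "ennreal (\<Sum>k\<le>m. real k * pmf \<mu> k) \<le> S"
  proof -
    have "ennreal (\<Sum>k\<le>m. real k * pmf \<mu> k) = (\<Sum>k\<le>m. ennreal (real k powr 1 * pmf \<mu> k))"
      by (subst sum_ennreal[symmetric]) auto
    also have "\<dots> \<le> S" unfolding S_def by (intro sum_le_suminf) auto
    finally show ?thesis .
  qed
  moreover have "S = ennreal (enn2real S)" using S by (simp add: less_top)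
  ultimately show ?thesis
    by (metis ennreal_le_iff enn2real_nonneg order_trans)
qed

lemma moment_norm_partial_sum_unbounded:
  assumes "moment_norm 2 \<mu> = \<infinity>"
  shows "\<exists>K. C \<le> (\<Sum>k\<le>K. (real k)\<^sup>2 * pmf \<mu> k)"
proof (rule ccontr)
  assume *: "\<not> ?thesis"
  define S where "S = (\<Sum>k. ennreal (real k powr 2 * pmf \<mu> k))"
  have "S \<le> ennreal C"
    unfolding S_def
  proof (rule suminf_le_const)
    fix n
    have "(\<Sum>k<n. ennreal (real k powr 2 * pmf \<mu> k)) \<le> (\<Sum>k\<le>n. ennreal (real k powr 2 * pmf \<mu> k))"
      by (intro sum_mono2) auto
    also have "\<dots> = ennreal (\<Sum>k\<le>n. (real k)\<^sup>2 * pmf \<mu> k)"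
      by (subst sum_ennreal) (auto simp: powr_numeral intro!: arg_cong[of _ _ ennreal] sum.cong)
    also have "\<dots> \<le> ennreal C" using * by (intro ennreal_leI) (auto simp: not_le less_imp_le)
    finally show "(\<Sum>k<n. ennreal (real k powr 2 * pmf \<mu> k)) \<le> ennreal C" .
  qed auto
  then have "S \<noteq> \<infinity>" by (auto simp: top_unique)
  then show False using assms by (simp add: moment_norm_def S_def)
qed

lemma infinite_variance_offspring_fps:
  assumes m1: "moment_norm 1 \<mu> \<le> 1" and m2: "moment_norm 2 \<mu> = \<infinity>"
  shows "infinite_variance_offspring (offspring_fps \<mu>)"
proof -
  note mean = moment_norm_partial_sum_le[OF m1]
  note second = moment_norm_partial_sum_unbounded[OF m2]
  have unbounded: "\<exists>K. C \<le> (\<Sum>k=2..K. pmf \<mu> k * (real k - 1)\<^sup>2)" for C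
  proof -
    \<comment> \<open>The factor \<open>4\<close> is the cost of
      \<open>k\<^sup>2 \<le> 4 * (k - 1)\<^sup>2\<close> for \<open>k \<ge> 2\<close>; the
      \<open>1\<close> covers \<open>k = 0\<close> and \<open>k = 1\<close>.\<close>
    obtain K where K: "4 * C + 1 \<le> (\<Sum>k\<le>K. (real k)\<^sup>2 * pmf \<mu> k)" using second by blast
    also have "\<dots> \<le> (\<Sum>k\<in>{0, 1} \<union> {2..K}. (real k)\<^sup>2 * pmf \<mu> k)"
      by (intro sum_mono2) auto
    also have "\<dots> = (\<Sum>k\<in>{0, 1}. (real k)\<^sup>2 * pmf \<mu> k) + (\<Sum>k=2..K. (real k)\<^sup>2 * pmf \<mu> k)"
      by (intro sum.union_disjoint) auto
    also have "(\<Sum>k\<in>{0, 1}. (real k)\<^sup>2 * pmf \<mu> k) \<le> 1" by (simp add: pmf_le_1)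
    also have "(\<Sum>k=2..K. (real k)\<^sup>2 * pmf \<mu> k) \<le> (\<Sum>k=2..K. 4 * (pmf \<mu> k * (real k - 1)\<^sup>2))"
    proof (rule sum_mono)
      fix k assume "k \<in> {2..K}"
      then have "(real k)\<^sup>2 \<le> (2 * (real k - 1))\<^sup>2" by (intro power_mono) auto
      then have "(real k)\<^sup>2 * pmf \<mu> k \<le> (4 * (real k - 1)\<^sup>2) * pmf \<mu> k"
        unfolding power_mult_distrib by (intro mult_right_mono) auto
      then show "(real k)\<^sup>2 * pmf \<mu> k \<le> 4 * (pmf \<mu> k * (real k - 1)\<^sup>2)" by (simp add: mult_ac)
    qed
    finally show ?thesis by (intro exI[of _ K]) (simp add: sum_distrib_left[symmetric])
  qed
  show ?thesis
  proof
    show "(\<lambda>k. offspring_fps \<mu> $ k) sums 1" using pmf_sums_1[of \<mu>] by simp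
    show "(\<Sum>k\<le>m. real k * offspring_fps \<mu> $ k) \<le> 1" for m using mean by simp
    show "\<exists>K. C \<le> (\<Sum>k=2..K. offspring_fps \<mu> $ k * (real k - 1)\<^sup>2)" for C using unbounded by simp
    show "0 < offspring_fps \<mu> $ 0"
    proof (rule ccontr)
      assume "\<not> ?thesis"
      \<comment> \<open>Without mass at \<open>0\<close>, all terms
        \<open>(real j - 1) * pmf \<mu> j\<close> are nonnegative, while the mean bound forces their
        total to be at most \<open>0\<close>. So there is no mass at \<open>k \<ge> 2\<close>,
        contradicting \<open>unbounded\<close>.\<close>
      then have 0: "pmf \<mu> 0 = 0" using pmf_nonneg[of \<mu> 0] by simp
      have "pmf \<mu> k = 0" if k: "2 \<le> k" for k
      proof -
        have "(real k - 1) * pmf \<mu> k \<le> 1 - (\<Sum>j\<le>m. pmf \<mu> j)" if "k \<le> m" for m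
        proof -
          have "(real k - 1) * pmf \<mu> k \<le> (\<Sum>j\<le>m. (real j - 1) * pmf \<mu> j)"
            using that
          proof (intro member_le_sum)
            fix j assume "j \<in> {..m} - {k}"
            show "0 \<le> (real j - 1) * pmf \<mu> j" using 0 by (cases j) auto
          qed auto
          also have "\<dots> = (\<Sum>j\<le>m. real j * pmf \<mu> j) - (\<Sum>j\<le>m. pmf \<mu> j)"
            by (simp add: algebra_simps sum_subtractf)
          finally show ?thesis using mean[of m] by linarith
        qed
        moreover have "(\<lambda>m. 1 - (\<Sum>j\<le>m. pmf \<mu> j)) \<longlonglongrightarrow> 1 - 1"
          using pmf_sums_1[of \<mu>] by (intro tendsto_diff) (auto simp: sums_def_le)
        ultimately have "(real k - 1) * pmf \<mu> k \<le> 1 - 1"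
          by (rule LIMSEQ_le_const[rotated, OF exI[of _ k, OF allI[OF impI]]])
        then show ?thesis using k pmf_nonneg[of \<mu> k] by (simp add: mult_le_0_iff)
      qed
      then have "(\<Sum>k=2..K. pmf \<mu> k * (real k - 1)\<^sup>2) = 0" for K by (intro sum.neutral) auto
      then show False using unbounded[of 1] by simp
    qed
    show "\<exists>k\<ge>k0. exp (- \<eta> * real k) \<le> offspring_fps \<mu> $ k" if "0 < \<eta>" for \<eta> k0
    proof (rule ccontr)
      \<comment> \<open>If the masses were eventually below \<open>exp (- \<eta> * k)\<close>, the
        second moment would be finite.\<close>
      assume *: "\<not> ?thesis"
      have "\<forall>\<^sub>F k in sequentially. (real k)\<^sup>2 * exp (- \<eta> * real k) \<le> inverse ((real k)\<^sup>2)"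
        using that by real_asymp
      then have "\<forall>\<^sub>F k in sequentially. norm ((real k)\<^sup>2 * pmf \<mu> k) \<le> inverse ((real k)\<^sup>2)"
        using eventually_ge_at_top[of k0]
      proof eventually_elim
        case (elim k)
        have "\<not> exp (- \<eta> * real k) \<le> offspring_fps \<mu> $ k" using * elim(2) by blast
        then have "pmf \<mu> k \<le> exp (- \<eta> * real k)" by simp
        then have "(real k)\<^sup>2 * pmf \<mu> k \<le> (real k)\<^sup>2 * exp (- \<eta> * real k)"
          by (rule mult_left_mono) simp
        then show ?case using elim by simp
      qed
      then have s: "summable (\<lambda>k. (real k)\<^sup>2 * pmf \<mu> k)"
        using inverse_power_summable[of 2, where 'a = real] by (rule summable_comparison_test_ev) simp
      have le: "(\<Sum>k\<le>K. (real k)\<^sup>2 * pmf \<mu> k) \<le> (\<Sum>k. (real k)\<^sup>2 * pmf \<mu> k)" for K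
        by (rule sum_le_suminf[OF s]) auto
      moreover obtain K where "(\<Sum>k. (real k)\<^sup>2 * pmf \<mu> k) + 1 \<le> (\<Sum>k\<le>K. (real k)\<^sup>2 * pmf \<mu> k)"
        using second by blast
      ultimately show False using le[of K] by linarith
    qed
  qed simp
qed

text \<open>The expectation is treated first, with \<open>height_first_moment\<close> for
  arbitrarily small parameters; Markov's inequality then gives convergence in probability.\<close>

theorem theorem1:
  fixes \<mu> :: "nat pmf"
  assumes "moment_norm 1 \<mu> \<le> 1"
    and "moment_norm 2 \<mu> = \<infinity>"
  shows "tendsto_in_prob (cond_offspring_space \<mu>)
           (\<lambda>n \<xi>. real n powr (- 1 / 2) * real (ht (family_tree \<xi>))) 0
           (inf sequentially (principal (attainable_sizes \<mu>)))
       \<and> ((\<lambda>n. integral\<^sup>L (cond_offspring_space \<mu> n)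
                   (\<lambda>\<xi>. real n powr (- 1 / 2) * real (ht (family_tree \<xi>)))) \<longlongrightarrow> 0)
           (inf sequentially (principal (attainable_sizes \<mu>)))"
proof -
  let ?\<phi> = "offspring_fps \<mu>"
  let ?F = "inf sequentially (principal (attainable_sizes \<mu>))"
  let ?X = "\<lambda>n \<xi>. real n powr (- 1 / 2) * real (ht (family_tree \<xi>))"
  let ?E = "\<lambda>n. \<integral>\<xi>. ?X n \<xi> \<partial>cond_offspring_space \<mu> n"
  interpret infinite_variance_offspring ?\<phi> by (rule infinite_variance_offspring_fps[OF assms])
  have E_eq: "?E n = real n powr (- 1 / 2) * (tree_gf ?\<phi> (\<lambda>t. real (height t)) $ n / tree_prob $ n)"
    if "n \<in> attainable_sizes \<mu>" for n
  proof -
    have "(\<lambda>\<xi>. real (ht (family_tree \<xi>))) \<in> borel_measurable (offspring_space \<mu>)" by measurable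
    from expectation_cond_family_tree[OF that, of "\<lambda>t. real (ht t)", OF this] show ?thesis
      by (simp add: tree_gf_def ht_vertices)
  qed
  have Q_pos: "0 < tree_prob $ n" if "n \<in> attainable_sizes \<mu>" for n
    using that by (simp add: attainable_sizes_def measure_size_event tree_gf_def)
  have E_nonneg: "0 \<le> ?E n" for n by (rule Bochner_Integration.integral_nonneg) simp
  have small: "\<forall>\<^sub>F n in ?F. ?E n < e" if e: "0 < e" for e
  proof -
    \<comment> \<open>With \<open>e / 8\<close> the normalized bound tends to
      \<open>4 * (e / 8) = e / 2\<close>, which is below \<open>e\<close>.\<close>
    obtain n0 where n0: "\<And>n. tree_gf ?\<phi> (\<lambda>t. real (height t)) $ n
        \<le> (real n0 + 4 * (e / 8) * sqrt (real n)) * tree_prob $ n"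
      by (rule height_first_moment[of "e / 8"]) (simp add: e, blast)
    have "\<forall>\<^sub>F n in sequentially. real n powr (- 1 / 2) * (real n0 + 4 * (e / 8) * sqrt (real n)) < e"
      using e by real_asymp
    then show ?thesis
      unfolding eventually_inf_principal
    proof eventually_elim
      case (elim n)
      show ?case
      proof
        assume n: "n \<in> attainable_sizes \<mu>"
        have "?E n \<le> real n powr (- 1 / 2) * (real n0 + 4 * (e / 8) * sqrt (real n))"
          unfolding E_eq[OF n] using n0[of n] Q_pos[OF n]
          by (intro mult_left_mono) (auto simp: divide_le_eq)
        with elim show "?E n < e" by simp
      qed
    qed
  qed
  have lim: "(?E \<longlongrightarrow> 0) ?F"
  proof (rule order_tendstoI)
    fix a :: real assume "a < 0"
    then have "a < ?E n" for n using E_nonneg[of n] by linarith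
    then show "\<forall>\<^sub>F n in ?F. a < ?E n" by (rule always_eventually[OF allI])
  qed (rule small)
  have "((\<lambda>n. measure (cond_offspring_space \<mu> n)
      {\<xi> \<in> space (cond_offspring_space \<mu> n). \<bar>?X n \<xi> - 0\<bar> > \<epsilon>}) \<longlongrightarrow> 0) ?F" if \<epsilon>: "0 < \<epsilon>" for \<epsilon>
  proof (rule tendsto_sandwich[OF _ _ tendsto_const])
    show "((\<lambda>n. ?E n / \<epsilon>) \<longlongrightarrow> 0) ?F"
      using tendsto_divide[OF lim tendsto_const[of \<epsilon>]] \<epsilon> by simp
    show "\<forall>\<^sub>F n in ?F. measure (cond_offspring_space \<mu> n)
      {\<xi> \<in> space (cond_offspring_space \<mu> n). \<bar>?X n \<xi> - 0\<bar> > \<epsilon>} \<le> ?E n / \<epsilon>"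
      unfolding eventually_inf_principal
    proof (intro always_eventually allI impI)
      fix n assume n: "n \<in> attainable_sizes \<mu>"
      let ?M = "cond_offspring_space \<mu> n"
      interpret M: prob_space ?M by (rule prob_space_cond_offspring_space[OF n])
      have int: "integrable ?M (?X n)"
        by (intro integrable_mult_right integrable_ht_family_tree[OF n])
      then have meas: "?X n \<in> borel_measurable ?M" by (rule borel_measurable_integrable)
      have "measure ?M {\<xi> \<in> space ?M. \<bar>?X n \<xi> - 0\<bar> > \<epsilon>} \<le> measure ?M {\<xi> \<in> space ?M. \<epsilon> \<le> ?X n \<xi>}"
      proof (rule M.finite_measure_mono)
        have "\<epsilon> \<le> ?X n \<xi>" if "\<bar>?X n \<xi> - 0\<bar> > \<epsilon>" for \<xi>
        proof -
          have "0 \<le> ?X n \<xi>" by simp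
          with that show ?thesis by linarith
        qed
        then show "{\<xi> \<in> space ?M. \<bar>?X n \<xi> - 0\<bar> > \<epsilon>} \<subseteq> {\<xi> \<in> space ?M. \<epsilon> \<le> ?X n \<xi>}"
          by blast
        show "{\<xi> \<in> space ?M. \<epsilon> \<le> ?X n \<xi>} \<in> sets ?M"
          by (rule borel_measurable_le[OF borel_measurable_const meas])
      qed
      also have "\<dots> \<le> ?E n / \<epsilon>"
        by (rule integral_Markov_inequality_measure[OF int sets.empty_sets _ \<epsilon>]) simp
      finally show "measure ?M {\<xi> \<in> space ?M. \<bar>?X n \<xi> - 0\<bar> > \<epsilon>} \<le> ?E n / \<epsilon>" .
    qed
  qed simp
  with lim show ?thesis unfolding tendsto_in_prob_def by simp
qed

end
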